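(* Let $X$ be a set, let $\Lambda$ and $\mathcal{W}$ be uniform Banach spaces, and let $K:X\times X\to\mathcal{M}(\Lambda)$ and $\Phi:X\to\mathcal{L}(\mathcal{W},\Lambda)$ satisfy $$K(x,y)=\Phi(y)\Phi^\dag(x),\ \ x,y\in X,\qquad \overline{\operatorname{span}}\{(\Phi^\dag(x)\xi)^*:x\in X,\ \xi\in\Lambda\}=\mathcal{W}^*,$$ where $\Phi^\dag(x):=(\Phi(x))^\dag$ is the generalized adjoint of $\Phi(x)$. Then the linear vector space $$\mathcal{B}:=\{\Phi(\cdot)u:\ u\in\mathcal{W}\}$$ of functions $x\mapsto\Phi(x)u$ from $X$ to $\Lambda$, endowed with the norm $$\|\Phi(\cdot)u\|_{\mathcal{B}}:=\|u\|_{\mathcal{W}},\quad u\in\mathcal{W},$$ and compatible semi-inner product $$[\Phi(\cdot)u,\Phi(\cdot)v]_{\mathcal{B}}:=[u,v]_{\mathcal{W}},\quad u,v\in\mathcal{W},$$ is a $\Lambda$-valued RKBS on $X$ with the reproducing kernel $K$.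
   Context: Banach spaces are over $\mathbb{C}$. A semi-inner product on a Banach space $V$ is a function $[\cdot,\cdot]_V:V\times V\to\mathbb{C}$ that is linear in its first variable, conjugate homogeneous in its second ($[f,\alpha g]_V=\overline{\alpha}[f,g]_V$), positive ($[f,f]_V>0$ for $f\neq0$), and satisfies $|[f,g]_V|\le[f,f]_V^{1/2}[g,g]_V^{1/2}$. It is compatible if $[f,f]_V^{1/2}=\|f\|_V$ for all $f\in V$. $V$ is uniformly convex if for all $\varepsilon>0$ there is $\delta>0$ with $\|f+g\|_V\le2-\delta$ whenever $\|f\|_V=\|g\|_V=1$ and $\|f-g\|_V\ge\varepsilon$. $V$ is uniformly Fréchet differentiable if $\lim_{t\in\mathbb{R},t\to0}(\|f+tg\|_V-\|f\|_V)/t$ exists uniformly over $f,g$ in the unit sphere of $V$. $V$ is called uniform if it is both uniformly convex and uniformly Fréchet differentiable. A uniform Banach space $V$ has a unique compatible semi-inner product, always denoted $[\cdot,\cdot]_V$; for $f\in V$, $f^*\in V^*$ is the functional $f^*(g)=[g,f]_V$, and the duality mapping $\mathcal{J}_V:V\to V^*$, $\mathcal{J}_V(f)=f^*$, is bijective and isometric (Giles). For Banach spaces $V_1,V_2$, $\mathcal{M}(V_1,V_2)$ is the set of all (not necessarily linear) maps $T:V_1\to V_2$ for which there is $\alpha\ge0$ with $\|Tu\|_{V_2}\le\alpha\|u\|_{V_1}$ for all $u\in V_1$. $\mathcal{M}(V):=\mathcal{M}(V,V)$, and $\mathcal{L}(V_1,V_2)$ is the subset of linear maps. For uniform $V_1,V_2$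 and $T\in\mathcal{L}(V_1,V_2)$, the generalized adjoint $T^\dag\in\mathcal{M}(V_2,V_1)$ is defined by $[Tu,v]_{V_2}=[u,T^\dag v]_{V_1}$ for all $u\in V_1$, $v\in V_2$; equivalently $T^\dag=\mathcal{J}_{V_1}^{-1}T^*\mathcal{J}_{V_2}$. A Banach space of $\Lambda$-valued functions on $X$ is a Banach space $\mathcal{B}$ consisting of functions $X\to\Lambda$ such that $\|f\|_{\mathcal{B}}=0$ iff $f(x)=0$ for all $x\in X$. A $\Lambda$-valued RKBS on $X$ is a Banach space $\mathcal{B}$ of functions from $X$ to $\Lambda$, with both $\mathcal{B}$ and $\Lambda$ uniform, such that for every $x\in X$ the point evaluation $f\mapsto f(x)$ is continuous from $\mathcal{B}$ to $\Lambda$. The reproducing kernel of $\mathcal{B}$ is the unique function $K:X\times X\to\mathcal{M}(\Lambda)$ such that $K(x,\cdot)\xi\in\mathcal{B}$ and $[f(x),\xi]_\Lambda=[f,K(x,\cdot)\xi]_{\mathcal{B}}$ for all $f\in\mathcal{B}$, $x\in X$, $\xi\in\Lambda$, where $K(x,\cdot)\xi$ denotes the function $y\mapsto K(x,y)\xi$. *)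

theory Defs
  imports "HOL-Analysis.Analysis" "HOL-Library.Function_Algebras"
begin

section \<open>Complex vector spaces\<close>

class complex_vector = ab_group_add +
  fixes scaleC :: "complex \<Rightarrow> 'a \<Rightarrow> 'a"  (infixr "*\<^sub>C" 75)
  assumes scaleC_add_right: "a *\<^sub>C (x + y) = a *\<^sub>C x + a *\<^sub>C y"
    and scaleC_add_left: "(a + b) *\<^sub>C x = a *\<^sub>C x + b *\<^sub>C x"
    and scaleC_scaleC: "a *\<^sub>C b *\<^sub>C x = (a * b) *\<^sub>C x"
    and scaleC_one: "1 *\<^sub>C x = x"

global_interpretation complex_vector: vector_space "scaleC :: complex \<Rightarrow> 'a \<Rightarrow> 'a::complex_vector"
  by unfold_locales (fact scaleC_add_right scaleC_add_left scaleC_scaleC scaleC_one)+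

abbreviation csubspace :: "'a::complex_vector set \<Rightarrow> bool"
  where "csubspace \<equiv> module.subspace scaleC"

abbreviation cspan :: "'a::complex_vector set \<Rightarrow> 'a set"
  where "cspan \<equiv> module.span scaleC"

instantiation complex :: complex_vector
begin

definition scaleC_complex :: "complex \<Rightarrow> complex \<Rightarrow> complex"
  where "scaleC_complex a x = a * x"

instance
  by standard (simp_all add: scaleC_complex_def algebra_simps)

end

instantiation "fun" :: (type, complex_vector) complex_vector
begin

definition scaleC_fun :: "complex \<Rightarrow> ('a \<Rightarrow> 'b) \<Rightarrow> 'a \<Rightarrow> 'b"
  where "scaleC_fun a f = (\<lambda>x. a *\<^sub>C f x)"

instance
  by standard
    (simp_all add: scaleC_fun_def fun_eq_iff scaleC_add_right scaleC_add_left scaleC_scaleC scaleC_one)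

end

text \<open>
  Functions \<open>A \<rightarrow> B\<close> are represented by total functions extended by \<open>0\<close> outside \<open>A\<close>.
  This is a bijective encoding; unlike extension by \<^const>\<open>undefined\<close>, it is compatible
  with the pointwise vector space operations on the function type.
\<close>

definition extend0 :: "'a set \<Rightarrow> ('a \<Rightarrow> 'b) \<Rightarrow> 'a \<Rightarrow> 'b::zero"
  where "extend0 A f = (\<lambda>x. if x \<in> A then f x else 0)"

definition funs :: "'a set \<Rightarrow> 'b set \<Rightarrow> ('a \<Rightarrow> 'b::zero) set"
  where "funs A B = {f. f \<in> A \<rightarrow> B \<and> (\<forall>x. x \<notin> A \<longrightarrow> f x = 0)}"


section \<open>Normed spaces and Banach spaces\<close>

text \<open>
  A space is a set of points in an ambient complex vector space, with a norm whose values are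
  only relevant on that set. Carriers are explicit so that dual spaces and spaces of functions
  are spaces in the same sense as the spaces they are built from.
\<close>

record 'a space =
  points :: "'a set"
  nrm :: "'a \<Rightarrow> real"

definition complex_normed_space :: "'a::complex_vector space \<Rightarrow> bool"
  where "complex_normed_space V \<longleftrightarrow>
    csubspace (points V) \<and>
    (\<forall>f\<in>points V. 0 \<le> nrm V f) \<and>
    (\<forall>f\<in>points V. nrm V f = 0 \<longleftrightarrow> f = 0) \<and>
    (\<forall>a. \<forall>f\<in>points V. nrm V (a *\<^sub>C f) = cmod a * nrm V f) \<and>
    (\<forall>f\<in>points V. \<forall>g\<in>points V. nrm V (f + g) \<le> nrm V f + nrm V g)"

text \<open>The locale \<^locale>\<open>Metric_space\<close> asks for symmetry and nonnegativity on the whole type.\<close>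

definition ndist :: "'a::complex_vector space \<Rightarrow> 'a \<Rightarrow> 'a \<Rightarrow> real"
  where "ndist V f g = (if f \<in> points V \<and> g \<in> points V then nrm V (f - g) else 0)"

lemma Metric_space_ndist:
  assumes "complex_normed_space V"
  shows "Metric_space (points V) (ndist V)"
proof
  have V: "csubspace (points V)" using assms by (simp add: complex_normed_space_def)
  note diff = complex_vector.subspace_diff[OF V]
  have minus: "nrm V (f - g) = nrm V (g - f)" if "f \<in> points V" "g \<in> points V" for f g
  proof -
    have "nrm V ((-1) *\<^sub>C (g - f)) = nrm V (g - f)"
      using assms diff[OF that(2,1)] unfolding complex_normed_space_def
      by (metis mult_1 norm_minus_cancel norm_one)
    then show ?thesis by (simp add: complex_vector.scale_minus_left)
  qed
  fix f g h
  show "0 \<le> ndist V f g"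
    using assms diff by (simp add: ndist_def complex_normed_space_def)
  show "ndist V f g = ndist V g f"
    using minus by (simp add: ndist_def)
  show "ndist V f g = 0 \<longleftrightarrow> f = g" if "f \<in> points V" "g \<in> points V"
    using that assms diff by (simp add: ndist_def complex_normed_space_def)
  show "ndist V f h \<le> ndist V f g + ndist V g h"
    if "f \<in> points V" "g \<in> points V" "h \<in> points V"
  proof -
    have "nrm V ((f - g) + (g - h)) \<le> nrm V (f - g) + nrm V (g - h)"
      using assms diff[OF that(1,2)] diff[OF that(2,3)]
      unfolding complex_normed_space_def by blast
    then show ?thesis using that by (simp add: ndist_def)
  qed
qed

abbreviation ntop :: "'a::complex_vector space \<Rightarrow> 'a topology"
  where "ntop V \<equiv> Metric_space.mtopology (points V) (ndist V)"

definition banach_space :: "'a::complex_vector space \<Rightarrow> bool"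
  where "banach_space V \<longleftrightarrow>
    complex_normed_space V \<and> Metric_space.mcomplete (points V) (ndist V)"

definition unit_sphere :: "'a::complex_vector space \<Rightarrow> 'a set"
  where "unit_sphere V = {f \<in> points V. nrm V f = 1}"

definition uniformly_convex :: "'a::complex_vector space \<Rightarrow> bool"
  where "uniformly_convex V \<longleftrightarrow>
    (\<forall>\<epsilon>>0. \<exists>\<delta>>0. \<forall>f\<in>unit_sphere V. \<forall>g\<in>unit_sphere V.
      nrm V (f - g) \<ge> \<epsilon> \<longrightarrow> nrm V (f + g) \<le> 2 - \<delta>)"

definition uniformly_frechet_differentiable :: "'a::complex_vector space \<Rightarrow> bool"
  where "uniformly_frechet_differentiable V \<longleftrightarrow>
    (\<exists>D. uniform_limit (unit_sphere V \<times> unit_sphere V)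
      (\<lambda>t (f, g). (nrm V (f + complex_of_real t *\<^sub>C g) - nrm V f) / t) D (at (0::real)))"

definition uniform_space :: "'a::complex_vector space \<Rightarrow> bool"
  where "uniform_space V \<longleftrightarrow>
    banach_space V \<and> uniformly_convex V \<and> uniformly_frechet_differentiable V"


section \<open>Semi-inner products\<close>

definition semi_inner_product :: "'a::complex_vector space \<Rightarrow> ('a \<Rightarrow> 'a \<Rightarrow> complex) \<Rightarrow> bool"
  where "semi_inner_product V S \<longleftrightarrow>
    (\<forall>f\<in>points V. \<forall>g\<in>points V. \<forall>h\<in>points V. S (f + g) h = S f h + S g h) \<and>
    (\<forall>a. \<forall>f\<in>points V. \<forall>g\<in>points V. S (a *\<^sub>C f) g = a * S f g) \<and>
    (\<forall>a. \<forall>f\<in>points V. \<forall>g\<in>points V. S f (a *\<^sub>C g) = cnj a * S f g) \<and>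
    (\<forall>f\<in>points V. f \<noteq> 0 \<longrightarrow> S f f \<in> \<real> \<and> Re (S f f) > 0) \<and>
    (\<forall>f\<in>points V. \<forall>g\<in>points V. cmod (S f g) \<le> sqrt (Re (S f f)) * sqrt (Re (S g g)))"

definition compatible :: "'a::complex_vector space \<Rightarrow> ('a \<Rightarrow> 'a \<Rightarrow> complex) \<Rightarrow> bool"
  where "compatible V S \<longleftrightarrow> (\<forall>f\<in>points V. sqrt (Re (S f f)) = nrm V f)"

text \<open>The compatible semi-inner product of a uniform space, extended by \<open>0\<close>.\<close>

definition sip :: "'a::complex_vector space \<Rightarrow> 'a \<Rightarrow> 'a \<Rightarrow> complex"
  where "sip V = (THE S. semi_inner_product V S \<and> compatible V S \<and>
    (\<forall>f g. f \<notin> points V \<or> g \<notin> points V \<longrightarrow> S f g = 0))"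


section \<open>Maps between spaces and the generalized adjoint\<close>

definition bdd_maps ::
  "'a::complex_vector space \<Rightarrow> 'b::complex_vector space \<Rightarrow> ('a \<Rightarrow> 'b) set"
  where "bdd_maps V W = {T \<in> funs (points V) (points W).
    \<exists>\<alpha>\<ge>0. \<forall>u\<in>points V. nrm W (T u) \<le> \<alpha> * nrm V u}"

definition lin_maps ::
  "'a::complex_vector space \<Rightarrow> 'b::complex_vector space \<Rightarrow> ('a \<Rightarrow> 'b) set"
  where "lin_maps V W = {T \<in> bdd_maps V W.
    (\<forall>u\<in>points V. \<forall>v\<in>points V. T (u + v) = T u + T v) \<and>
    (\<forall>a. \<forall>u\<in>points V. T (a *\<^sub>C u) = a *\<^sub>C T u)}"

definition scalars :: "complex space"
  where "scalars = \<lparr>points = UNIV, nrm = cmod\<rparr>"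

definition dual :: "'a::complex_vector space \<Rightarrow> ('a \<Rightarrow> complex) space"
  where "dual V = \<lparr>points = lin_maps V scalars,
    nrm = (\<lambda>\<phi>. SUP f\<in>{f \<in> points V. nrm V f \<le> 1}. cmod (\<phi> f))\<rparr>"

definition duality_map :: "'a::complex_vector space \<Rightarrow> 'a \<Rightarrow> 'a \<Rightarrow> complex"
  where "duality_map V f = extend0 (points V) (\<lambda>g. sip V g f)"

definition gadj ::
  "'a::complex_vector space \<Rightarrow> 'b::complex_vector space \<Rightarrow> ('a \<Rightarrow> 'b) \<Rightarrow> 'b \<Rightarrow> 'a"
  where "gadj V W T = (THE S. S \<in> bdd_maps W V \<and>
    (\<forall>u\<in>points V. \<forall>v\<in>points W. sip W (T u) v = sip V u (S v)))"


section \<open>Vector-valued reproducing kernel Banach spaces\<close>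

definition banach_function_space ::
  "'x set \<Rightarrow> 'l::complex_vector space \<Rightarrow> ('x \<Rightarrow> 'l) space \<Rightarrow> bool"
  where "banach_function_space X L B \<longleftrightarrow>
    banach_space B \<and> points B \<subseteq> funs X (points L) \<and>
    (\<forall>f\<in>points B. nrm B f = 0 \<longleftrightarrow> (\<forall>x\<in>X. f x = 0))"

definition rkbs :: "'x set \<Rightarrow> 'l::complex_vector space \<Rightarrow> ('x \<Rightarrow> 'l) space \<Rightarrow> bool"
  where "rkbs X L B \<longleftrightarrow>
    uniform_space L \<and> uniform_space B \<and> banach_function_space X L B \<and>
    (\<forall>x\<in>X. continuous_map (ntop B) (ntop L) (\<lambda>f. f x))"

definition reproducing ::
  "'x set \<Rightarrow> 'l::complex_vector space \<Rightarrow> ('x \<Rightarrow> 'l) space \<Rightarrow> ('x \<Rightarrow> 'x \<Rightarrow> 'l \<Rightarrow> 'l) \<Rightarrow> bool"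
  where "reproducing X L B K \<longleftrightarrow>
    (\<forall>x\<in>X. \<forall>y\<in>X. K x y \<in> bdd_maps L L) \<and>
    (\<forall>x\<in>X. \<forall>\<xi>\<in>points L. extend0 X (\<lambda>y. K x y \<xi>) \<in> points B) \<and>
    (\<forall>f\<in>points B. \<forall>x\<in>X. \<forall>\<xi>\<in>points L.
      sip L (f x) \<xi> = sip B f (extend0 X (\<lambda>y. K x y \<xi>)))"

definition is_reproducing_kernel ::
  "'x set \<Rightarrow> 'l::complex_vector space \<Rightarrow> ('x \<Rightarrow> 'l) space \<Rightarrow> ('x \<Rightarrow> 'x \<Rightarrow> 'l \<Rightarrow> 'l) \<Rightarrow> bool"
  where "is_reproducing_kernel X L B K \<longleftrightarrow>
    reproducing X L B K \<and>
    (\<forall>K'. reproducing X L B K' \<longrightarrow> (\<forall>x\<in>X. \<forall>y\<in>X. K' x y = K x y))"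

definition feature_fun :: "'x set \<Rightarrow> ('x \<Rightarrow> 'w \<Rightarrow> 'l::complex_vector) \<Rightarrow> 'w \<Rightarrow> 'x \<Rightarrow> 'l"
  where "feature_fun X \<Phi> u = extend0 X (\<lambda>x. \<Phi> x u)"

text \<open>
  The norm is only meaningful when all \<open>u\<close> representing the same function have the same norm.
\<close>

definition feature_space ::
  "'x set \<Rightarrow> 'w::complex_vector space \<Rightarrow> ('x \<Rightarrow> 'w \<Rightarrow> 'l::complex_vector) \<Rightarrow> ('x \<Rightarrow> 'l) space"
  where "feature_space X W \<Phi> = \<lparr>points = feature_fun X \<Phi> ` points W,
    nrm = (\<lambda>f. THE r. \<exists>u\<in>points W. f = feature_fun X \<Phi> u \<and> r = nrm W u)\<rparr>"

end

theory Submission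
  imports Defs
begin

text \<open>The norm of a uniform space is differentiable, and its derivative at \<open>f\<close> is the real part of
  the only functional touching the norm at \<open>f\<close>. This makes the compatible semi-inner product exist
  and be unique. Uniform convexity and completeness make bounded functionals attain their norm, so
  that they are represented by the semi-inner product and generalized adjoints exist. If
  \<open>\<Phi>(x) u = 0\<close> for all \<open>x \<in> X\<close>, then \<open>u\<close> is annihilated by all \<open>(\<Phi>\<^sup>\<dagger>(x) \<xi>)\<^sup>*\<close>, hence by the density
  hypothesis by all of \<open>W\<^sup>*\<close>, in particular by \<open>u\<^sup>*\<close>, and \<open>u = 0\<close>. So \<open>u \<mapsto> \<Phi>(\<cdot>) u\<close> is a linear isometry of
  \<open>W\<close> onto \<open>B\<close> along which all the structure is transported, and the reproducing property is the
  defining property of \<open>\<Phi>\<^sup>\<dagger>(x)\<close>.\<close>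

section \<open>The norm derivative\<close>

text \<open>Serves to turn a modulus into a real part: a bound on real parts of a complex linear
  functional, applied to rotated vectors, becomes a bound on its modulus.\<close>

lemma unimodular_rotation:
  obtains u where "cmod u = 1" "u * z = complex_of_real (cmod z)"
proof (cases "z = 0")
  case True
  then show ?thesis using that[of 1] by simp
next
  case False
  have "cnj z * z = cmod z * cmod z"
    using complex_norm_square[of z] by (simp add: power2_eq_square mult.commute)
  then show ?thesis using False that[of "cnj z / cmod z"] by (simp add: norm_divide)
qed

section \<open>Norm axioms, completeness and difference quotients of the norm\<close>

locale normed_points =
  fixes V :: "'a::complex_vector space"
  assumes normed: "complex_normed_space V"
begin

lemma subspace: "csubspace (points V)"
  using normed by (simp add: complex_normed_space_def)

lemmas zero_mem = complex_vector.subspace_0[OF subspace]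
  and add_mem = complex_vector.subspace_add[OF subspace]
  and diff_mem = complex_vector.subspace_diff[OF subspace]
  and scale_mem = complex_vector.subspace_scale[OF subspace]

lemma nrm_nonneg: "f \<in> points V \<Longrightarrow> 0 \<le> nrm V f"
  using normed by (simp add: complex_normed_space_def)

lemma nrm_eq_0: "f \<in> points V \<Longrightarrow> nrm V f = 0 \<longleftrightarrow> f = 0"
  using normed by (simp add: complex_normed_space_def)

lemma nrm_zero: "nrm V 0 = 0"
  using nrm_eq_0 zero_mem by simp

lemma nrm_pos: "f \<in> points V \<Longrightarrow> f \<noteq> 0 \<Longrightarrow> 0 < nrm V f"
  using nrm_eq_0 nrm_nonneg by fastforce

lemma nrm_scale: "f \<in> points V \<Longrightarrow> nrm V (a *\<^sub>C f) = cmod a * nrm V f"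
  using normed by (simp add: complex_normed_space_def)

lemma nrm_triangle: "f \<in> points V \<Longrightarrow> g \<in> points V \<Longrightarrow> nrm V (f + g) \<le> nrm V f + nrm V g"
  using normed by (simp add: complex_normed_space_def)

lemma nrm_minus_commute:
  assumes "f \<in> points V" "g \<in> points V"
  shows "nrm V (f - g) = nrm V (g - f)"
  using nrm_scale[OF diff_mem[OF assms(2,1)], of "-1"] by (simp add: complex_vector.scale_minus_left)

lemma nrm_diff_le:
  assumes "f \<in> points V" "g \<in> points V"
  shows "\<bar>nrm V f - nrm V g\<bar> \<le> nrm V (f - g)"
  using nrm_triangle[OF diff_mem[OF assms] assms(2)] nrm_triangle[OF diff_mem[OF assms(2,1)] assms(1)]
    nrm_minus_commute[OF assms] by simp

text \<open>Restates completeness through sequences and \<open>nrm\<close> alone. The default value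
  of \<open>ndist\<close> drops out because all points involved lie in the carrier.\<close>

lemma mcomplete_iff:
  "Metric_space.mcomplete (points V) (ndist V) \<longleftrightarrow>
    (\<forall>x::nat \<Rightarrow> 'a. (\<forall>n. x n \<in> points V) \<and> (\<forall>e>0. \<exists>N. \<forall>m\<ge>N. \<forall>n\<ge>N. nrm V (x m - x n) < e) \<longrightarrow>
      (\<exists>l\<in>points V. \<forall>e>0. \<exists>N. \<forall>n\<ge>N. nrm V (x n - l) < e))"
proof -
  interpret Metric_space "points V" "ndist V" by (rule Metric_space_ndist[OF normed])
  have cauchy: "MCauchy x \<longleftrightarrow> (\<forall>n. x n \<in> points V) \<and>
      (\<forall>e>0. \<exists>N. \<forall>m\<ge>N. \<forall>n\<ge>N. nrm V (x m - x n) < e)" for x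

    unfolding MCauchy_def image_subset_iff by (rule conj_cong) (simp_all add: ndist_def, meson?)
  have limit: "limitin mtopology x l sequentially \<longleftrightarrow>
      l \<in> points V \<and> (\<forall>e>0. \<exists>N. \<forall>n\<ge>N. nrm V (x n - l) < e)" if "\<forall>n. x n \<in> points V" for x l
    using that unfolding limit_metric_sequentially ndist_def by auto
  show ?thesis
    unfolding mcomplete_def cauchy Bex_def by (simp add: limit cong: conj_cong)
qed

definition nquot :: "'a \<Rightarrow> 'a \<Rightarrow> real \<Rightarrow> real"
  where "nquot f g t = (nrm V (f + complex_of_real t *\<^sub>C g) - nrm V f) / t"

text \<open>\<open>Lim\<close> is a total operator; \<open>nquot_tendsto\<close> shows that the
  limit exists at nonzero \<open>f\<close> in a smooth space, and the value is only used
  there.\<close>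

definition nder :: "'a \<Rightarrow> 'a \<Rightarrow> real"
  where "nder f g = Lim (at 0) (nquot f g)"

text \<open>Pulling the positive factor \<open>a\<close> out of the norm leaves the step
  \<open>t * b / a\<close>. This carries limits from the unit sphere to all nonzero points and
  yields homogeneity of the derivative.\<close>

lemma nquot_scale:
  assumes "f \<in> points V" "g \<in> points V" "0 < a"
  shows "nquot (complex_of_real a *\<^sub>C f) (complex_of_real b *\<^sub>C g) t = b * nquot f g (t * b / a)"
proof -
  have "complex_of_real a *\<^sub>C f + complex_of_real t *\<^sub>C complex_of_real b *\<^sub>C g =
    complex_of_real a *\<^sub>C (f + complex_of_real (t * b / a) *\<^sub>C g)"
    using assms(3) by (simp add: scaleC_add_right scaleC_scaleC)
  then have "nrm V (complex_of_real a *\<^sub>C f + complex_of_real t *\<^sub>C complex_of_real b *\<^sub>C g) =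
    a * nrm V (f + complex_of_real (t * b / a) *\<^sub>C g)"
    using assms nrm_scale[OF add_mem[OF assms(1) scale_mem[OF assms(2)]]] by simp
  then have "nquot (complex_of_real a *\<^sub>C f) (complex_of_real b *\<^sub>C g) t =
      a * (nrm V (f + complex_of_real (t * b / a) *\<^sub>C g) - nrm V f) / t"
    using assms nrm_scale[OF assms(1)] by (simp add: nquot_def right_diff_distrib)
  also have "\<dots> = b * nquot f g (t * b / a)"
    using assms(3) by (cases "b = 0") (simp_all add: nquot_def)
  finally show ?thesis .
qed

lemma nquot_le:
  assumes "f \<in> points V" "g \<in> points V" "0 < t"
  shows "nquot f g t \<le> nrm V g"
  using nrm_triangle[OF assms(1) scale_mem[OF assms(2)], of "complex_of_real t"]
    nrm_scale[OF assms(2), of "complex_of_real t"] assms(3)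
  by (simp add: nquot_def field_simps)

text \<open>Convexity of the norm: the point reached from \<open>f\<close> in direction
  \<open>g + h\<close> at step \<open>t\<close> is the midpoint of those reached in directions
  \<open>g\<close> and \<open>h\<close> at step \<open>2 * t\<close>. In the limit it makes the
  derivative subadditive.\<close>

lemma nquot_add_le:
  assumes "f \<in> points V" "g \<in> points V" "h \<in> points V" "0 < t"
  shows "nquot f (g + h) t \<le> nquot f g (2 * t) + nquot f h (2 * t)"
proof -
  let ?p = "f + complex_of_real (2 * t) *\<^sub>C g" and ?q = "f + complex_of_real (2 * t) *\<^sub>C h"
  have f: "2 *\<^sub>C f = f + f"
    using scaleC_add_left[of 1 1 f] by (simp add: scaleC_one)
  have "?p + ?q = 2 *\<^sub>C (f + complex_of_real t *\<^sub>C (g + h))"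
    using f by (simp add: scaleC_add_right scaleC_scaleC algebra_simps)
  moreover have "nrm V \<dots> = 2 * nrm V (f + complex_of_real t *\<^sub>C (g + h))"
    using assms nrm_scale[of "f + complex_of_real t *\<^sub>C (g + h)" 2] add_mem scale_mem by simp
  ultimately have "2 * nrm V (f + complex_of_real t *\<^sub>C (g + h)) \<le> nrm V ?p + nrm V ?q"
    using assms nrm_triangle[of ?p ?q] add_mem scale_mem by simp
  then have "(2 * (nrm V (f + complex_of_real t *\<^sub>C (g + h)) - nrm V f)) / (2 * t) \<le>
      ((nrm V ?p - nrm V f) + (nrm V ?q - nrm V f)) / (2 * t)"
    using assms(4) by (intro divide_right_mono) simp_all
  then show ?thesis
    unfolding nquot_def add_divide_distrib mult_divide_mult_cancel_left_if by simp
qed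

end

section \<open>Directional derivatives of the norm and support functionals\<close>

locale smooth_points = normed_points +
  assumes frechet: "uniformly_frechet_differentiable V"
begin

text \<open>Differentiability is given on the unit sphere only, so \<open>f\<close> and
  \<open>g\<close> are normalized first; a zero direction has constant quotient.\<close>

lemma nquot_tendsto:
  assumes f: "f \<in> points V" "f \<noteq> 0" and g: "g \<in> points V"
  shows "(nquot f g \<longlongrightarrow> nder f g) (at 0)"
proof -
  have "\<exists>d. (nquot f g \<longlongrightarrow> d) (at 0)"
  proof (cases "g = 0")
    case True
    then have "nquot f g = (\<lambda>t. 0)" by (simp add: nquot_def fun_eq_iff)
    then show ?thesis by auto
  next
    case False
    define a b where "a = nrm V f" and "b = nrm V g"
    have ab: "a > 0" "b > 0" using nrm_pos f g False by (auto simp: a_def b_def)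
    define f' g' where "f' = complex_of_real (1 / a) *\<^sub>C f" and "g' = complex_of_real (1 / b) *\<^sub>C g"
    have sphere: "f' \<in> unit_sphere V" "g' \<in> unit_sphere V"
      using f g ab scale_mem nrm_scale by (auto simp: f'_def g'_def unit_sphere_def norm_divide simp flip: a_def b_def)
    obtain D where D: "uniform_limit (unit_sphere V \<times> unit_sphere V)
        (\<lambda>t (f, g). (nrm V (f + complex_of_real t *\<^sub>C g) - nrm V f) / t) D (at 0)"
      using frechet by (auto simp: uniformly_frechet_differentiable_def)
    then have "((\<lambda>t. nquot f' g' t) \<longlongrightarrow> D (f', g')) (at 0)"
      using tendsto_uniform_limitI[OF D, of "(f', g')"] sphere by (simp add: nquot_def)
    \<comment> \<open>The target filter is punctured at \<open>0\<close>, so the rescaled step must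
      also stay nonzero.\<close>
    moreover have "filterlim (\<lambda>t. t * b / a) (at 0) (at 0)"
      using ab by (intro filterlim_atI) (auto intro!: tendsto_eq_intros simp: eventually_at_filter)
    ultimately have "((\<lambda>t. b * nquot f' g' (t * b / a)) \<longlongrightarrow> b * D (f', g')) (at 0)"
      by (intro tendsto_intros) (rule filterlim_compose)
    moreover have "f = complex_of_real a *\<^sub>C f'" "g = complex_of_real b *\<^sub>C g'"
      using ab by (simp_all add: f'_def g'_def scaleC_scaleC scaleC_one)
    then have "nquot f g t = b * nquot f' g' (t * b / a)" for t
      using nquot_scale[of f' g' a b t] sphere ab by (simp add: unit_sphere_def)
    then have "nquot f g = (\<lambda>t. b * nquot f' g' (t * b / a))" by (simp add: fun_eq_iff)
    ultimately show ?thesis by auto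
  qed
  then show ?thesis unfolding nder_def by (metis tendsto_Lim trivial_limit_at)
qed

text \<open>The inequalities between quotients hold for positive steps, so they are passed to the
  limit from the right.\<close>

lemma nquot_tendsto_right:
  assumes "f \<in> points V" "f \<noteq> 0" "g \<in> points V"
  shows "(nquot f g \<longlongrightarrow> nder f g) (at_right 0)"
  using nquot_tendsto[OF assms] tendsto_mono[OF at_le] by blast

lemma nder_le:
  assumes "f \<in> points V" "f \<noteq> 0" "g \<in> points V"
  shows "nder f g \<le> nrm V g"
  using nquot_tendsto_right[OF assms]
  by (rule tendsto_upperbound)
    (auto simp: eventually_at_filter intro!: always_eventually nquot_le assms)

text \<open>Substitutes \<open>t * r\<close> for \<open>t\<close>; the limit is two-sided, so
  negative \<open>r\<close> is covered. For \<open>r = 0\<close> the substitution would hit the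
  excluded point \<open>0\<close>, hence the separate case.\<close>

lemma nder_scale:
  assumes "f \<in> points V" "f \<noteq> 0" "g \<in> points V"
  shows "nder f (complex_of_real r *\<^sub>C g) = r * nder f g"
proof (cases "r = 0")
  case True
  have "nquot f (complex_of_real r *\<^sub>C g) = (\<lambda>t. 0)" using True by (simp add: nquot_def fun_eq_iff)
  then have "(nquot f (complex_of_real r *\<^sub>C g) \<longlongrightarrow> 0) (at 0)" by simp
  then show ?thesis using True nquot_tendsto[OF assms(1,2) scale_mem[OF assms(3)]]
    by (metis LIM_unique mult_zero_left)
next
  case False
  have "filterlim (\<lambda>t. t * r / 1) (at 0) (at 0)"
    using False by (intro filterlim_atI) (auto intro!: tendsto_eq_intros simp: eventually_at_filter)
  then have "((\<lambda>t. r * nquot f g (t * r / 1)) \<longlongrightarrow> r * nder f g) (at 0)"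
    by (intro tendsto_intros) (rule filterlim_compose[OF nquot_tendsto[OF assms]])
  then have "(nquot f (complex_of_real r *\<^sub>C g) \<longlongrightarrow> r * nder f g) (at 0)"
    by (rule Lim_transform_eventually)
      (use nquot_scale[OF assms(1,3), of 1 r] in \<open>simp add: scaleC_one\<close>)
  then show ?thesis using nquot_tendsto[OF assms(1,2) scale_mem[OF assms(3)]]
    by (metis LIM_unique)
qed

lemma nder_minus:
  assumes "f \<in> points V" "f \<noteq> 0" "g \<in> points V"
  shows "nder f (- g) = - nder f g"
  using nder_scale[OF assms, of "-1"] by (simp add: complex_vector.scale_minus_left scaleC_one)

text \<open>Convexity gives subadditivity, and oddness of the derivative turns it into
  additivity.\<close>

lemma nder_add:
  assumes "f \<in> points V" "f \<noteq> 0" "g \<in> points V" "h \<in> points V"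
  shows "nder f (g + h) = nder f g + nder f h"
proof -
  have double: "filterlim (\<lambda>t::real. 2 * t) (at_right 0) (at_right 0)"
    unfolding filterlim_at by (auto intro!: tendsto_eq_intros simp: eventually_at_filter)
  have le: "nder f (g + h) \<le> nder f g + nder f h" if "g \<in> points V" "h \<in> points V" for g h
  proof (rule tendsto_le[OF _ _ nquot_tendsto_right[OF assms(1,2) add_mem[OF that]]])
    show "((\<lambda>t. nquot f g (2 * t) + nquot f h (2 * t)) \<longlongrightarrow> nder f g + nder f h) (at_right 0)"
      using that assms(1,2)
      by (intro tendsto_add; intro filterlim_compose[OF nquot_tendsto_right double]) auto
    show "\<forall>\<^sub>F t in at_right 0. nquot f (g + h) t \<le> nquot f g (2 * t) + nquot f h (2 * t)"
      using that assms(1) by (auto simp: eventually_at_filter intro!: always_eventually nquot_add_le)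
  qed simp
  \<comment> \<open>Subadditivity for the decomposition of \<open>g\<close> into
    \<open>g + h\<close> and \<open>0 - h\<close>.\<close>
  have "nder f g \<le> nder f (g + h) - nder f h"
    using le[OF add_mem[OF assms(3,4)] diff_mem[OF zero_mem assms(4)]] nder_minus[OF assms(1,2,4)]
    by simp
  with le[OF assms(3,4)] show ?thesis by simp
qed

text \<open>For positive \<open>t\<close> the quotient of \<open>f\<close> in its own direction is
  constantly \<open>nrm V f\<close>.\<close>

lemma nder_self:
  assumes "f \<in> points V" "f \<noteq> 0"
  shows "nder f f = nrm V f"
proof -
  have "nder f f \<ge> nrm V f"
  proof (rule tendsto_lowerbound[OF nquot_tendsto_right[OF assms assms(1)]])
    have "nquot f f t = nrm V f" if "t > 0" for t
    proof -
      have "f + complex_of_real t *\<^sub>C f = complex_of_real (1 + t) *\<^sub>C f"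
        by (simp add: scaleC_add_left scaleC_one)
      then show ?thesis using that assms nrm_scale[of f "complex_of_real (1 + t)"]
        by (simp add: nquot_def field_simps del: of_real_add)
    qed
    then show "\<forall>\<^sub>F t in at_right 0. nrm V f \<le> nquot f f t"
      by (auto simp: eventually_at_filter intro!: always_eventually)
  qed simp
  with nder_le[OF assms assms(1)] show ?thesis by simp
qed

text \<open>The complex functional with real part \<open>nder f\<close>, since a complex linear
  \<phi> satisfies Im \<phi>(g) = - Re \<phi>(ig). For nonzero \<open>f\<close> it is the duality
  functional of \<open>f\<close> divided by the norm of \<open>f\<close>.\<close>

definition ndual :: "'a \<Rightarrow> 'a \<Rightarrow> complex"
  where "ndual f g = Complex (nder f g) (- nder f (\<i> *\<^sub>C g))"

lemma ndual_add:
  assumes "f \<in> points V" "f \<noteq> 0" "g \<in> points V" "h \<in> points V"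
  shows "ndual f (g + h) = ndual f g + ndual f h"
  using assms nder_add scale_mem by (simp add: ndual_def scaleC_add_right complex_eq_iff)

text \<open>Real factors come from \<open>nder_scale\<close>, the factor \<open>\<i>\<close> from
  the shape of \<open>ndual\<close> and oddness; a general scalar is split into real and imaginary
  part.\<close>

lemma ndual_scale:
  assumes "f \<in> points V" "f \<noteq> 0" "g \<in> points V"
  shows "ndual f (a *\<^sub>C g) = a * ndual f g"
proof -
  have re: "ndual f (complex_of_real r *\<^sub>C h) = r * ndual f h" if "h \<in> points V" for r h
    using nder_scale[OF assms(1,2) that, of r] nder_scale[OF assms(1,2) scale_mem[OF that], of r \<i>]
    by (simp add: ndual_def scaleC_scaleC complex_eq_iff mult.commute)
  have "ndual f (\<i> *\<^sub>C g) = \<i> * ndual f g"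
    using nder_minus[OF assms]
    by (simp add: ndual_def scaleC_scaleC complex_eq_iff scaleC_one complex_vector.scale_minus_left)
  moreover have "a *\<^sub>C g = complex_of_real (Re a) *\<^sub>C g + complex_of_real (Im a) *\<^sub>C (\<i> *\<^sub>C g)"
    by (metis complex_eq mult.commute scaleC_add_left scaleC_scaleC)
  ultimately have "ndual f (a *\<^sub>C g) = (Re a + Im a * \<i>) * ndual f g"
    using re[OF assms(3), of "Re a"] re[OF scale_mem[OF assms(3)], of "Im a" \<i>]
      ndual_add[OF assms(1,2) scale_mem[OF assms(3)] scale_mem[OF scale_mem[OF assms(3)]]]
    by (simp add: distrib_right)
  also have "Re a + Im a * \<i> = a" by (metis complex_eq mult.commute)
  finally show ?thesis .
qed

lemma cmod_ndual_le:
  assumes "f \<in> points V" "f \<noteq> 0" "g \<in> points V"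
  shows "cmod (ndual f g) \<le> nrm V g"
proof -
  obtain u where u: "cmod u = 1" "u * ndual f g = cmod (ndual f g)"
    by (rule unimodular_rotation)
  then have "cmod (ndual f g) = Re (ndual f (u *\<^sub>C g))"
    using ndual_scale[OF assms] by simp
  also have "\<dots> \<le> nrm V g"
    using nder_le[OF assms(1,2) scale_mem[OF assms(3)], of u] nrm_scale[OF assms(3), of u] u
    by (simp add: ndual_def)
  finally show ?thesis .
qed

text \<open>The real part already equals the norm, which bounds the modulus, so nothing is left for
  the imaginary part.\<close>

lemma ndual_self:
  assumes "f \<in> points V" "f \<noteq> 0"
  shows "ndual f f = nrm V f"
proof -
  have "Re (ndual f f) = nrm V f" using nder_self[OF assms] by (simp add: ndual_def)
  moreover from this have "Im (ndual f f) = 0"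
    using cmod_ndual_le[OF assms assms(1)] nrm_nonneg[OF assms(1)] cmod_eq_Re abs_Im_le_cmod
    by (smt (verit) cmod_power2 power2_less_eq_zero_iff power_mono zero_le_power2)
  ultimately show ?thesis by (simp add: complex_eq_iff)
qed

text \<open>The source of both the uniqueness of the compatible semi-inner product and the
  representation of functionals.\<close>

lemma support_functional_unique:
  assumes f: "f \<in> points V" "f \<noteq> 0" and g: "g \<in> points V"
    and add: "\<And>g h. g \<in> points V \<Longrightarrow> h \<in> points V \<Longrightarrow> \<phi> (g + h) = \<phi> g + \<phi> h"
    and scale: "\<And>a g. g \<in> points V \<Longrightarrow> \<phi> (a *\<^sub>C g) = a * \<phi> g"
    and le: "\<And>g. g \<in> points V \<Longrightarrow> Re (\<phi> g) \<le> c * nrm V g"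
    and touch: "Re (\<phi> f) = c * nrm V f"
  shows "\<phi> g = complex_of_real c * ndual f g"
proof -
  \<comment> \<open>Along \<open>f + t g\<close> the real part of \<phi> lies below \<open>c\<close>
    times the norm, with equality at \<open>t = 0\<close>; dividing by \<open>t\<close> compares its
    slope with the quotients.\<close>
  have bound: "Re (\<phi> g) \<le> c * nder f g" if g: "g \<in> points V" for g
  proof (rule tendsto_lowerbound)
    show "((\<lambda>t. c * nquot f g t) \<longlongrightarrow> c * nder f g) (at_right 0)"
      by (intro tendsto_intros nquot_tendsto_right f g)
    have "Re (\<phi> g) \<le> c * nquot f g t" if "t > 0" for t
      using le[OF add_mem[OF f(1) scale_mem[OF g]], of "complex_of_real t"] that touch
        add[OF f(1) scale_mem[OF g], of "complex_of_real t"] scale[OF g, of "complex_of_real t"]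
      by (simp add: nquot_def field_simps)
    then show "\<forall>\<^sub>F t in at_right 0. Re (\<phi> g) \<le> c * nquot f g t"
      by (auto simp: eventually_at_filter intro!: always_eventually)
  qed simp
  \<comment> \<open>Applying the bound to the opposite direction reverses the inequality, as both
    sides are odd.\<close>
  have re: "Re (\<phi> g) = c * nder f g" if g: "g \<in> points V" for g
    using bound[OF g] bound[OF diff_mem[OF zero_mem g]] nder_minus[OF f g] scale[OF g, of "-1"]
    by (simp add: complex_vector.scale_minus_left scaleC_one)
  have "Im (\<phi> g) = - Re (\<phi> (\<i> *\<^sub>C g))" using scale[OF g, of \<i>] by simp
  then show ?thesis
    using re[OF g] re[OF scale_mem[OF g]] by (simp add: ndual_def complex_eq_iff)
qed

end


section \<open>The compatible semi-inner product\<close>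

lemma sip_axioms:
  assumes "semi_inner_product V S" "f \<in> points V" "g \<in> points V"
  shows "h \<in> points V \<Longrightarrow> S (f + h) g = S f g + S h g"
    and "S (a *\<^sub>C f) g = a * S f g"
    and "S f (a *\<^sub>C g) = cnj a * S f g"
    and "f \<noteq> 0 \<Longrightarrow> S f f \<in> \<real>"
    and "f \<noteq> 0 \<Longrightarrow> 0 < Re (S f f)"
    and "cmod (S f g) \<le> sqrt (Re (S f f)) * sqrt (Re (S g g))"
  using assms by (simp_all add: semi_inner_product_def)

context smooth_points
begin

text \<open>By Cauchy-Schwarz the functional \<open>\<lambda>g. S g f\<close> stays below
  \<open>nrm V f\<close> times the norm, with equality at \<open>f\<close>, so it is the multiple of
  \<open>ndual f\<close> singled out by \<open>support_functional_unique\<close>.\<close>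

lemma compatible_sip_eq_ndual:
  assumes S: "semi_inner_product V S" and comp: "compatible V S"
    and f: "f \<in> points V" and g: "g \<in> points V"
  shows "S g f = complex_of_real (nrm V f) * ndual f g"
proof (cases "f = 0")
  case True
  then show ?thesis using sip_axioms(3)[OF S g f, of 0] by (simp add: nrm_zero)
next
  case False
  have sqrt: "sqrt (Re (S h h)) = nrm V h" if "h \<in> points V" for h
    using comp that by (simp add: compatible_def)
  show ?thesis
  proof (rule support_functional_unique[OF f False g, where \<phi> = "\<lambda>g. S g f"])
    fix h assume h: "h \<in> points V"
    show "Re (S h f) \<le> nrm V f * nrm V h"
      using sip_axioms(6)[OF S h f] complex_Re_le_cmod[of "S h f"] sqrt[OF h] sqrt[OF f]
      by (simp add: mult.commute)
    show "S (h + k) f = S h f + S k f" if "k \<in> points V" for k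
      using sip_axioms(1)[OF S h f that] .
    show "S (a *\<^sub>C h) f = a * S h f" for a
      using sip_axioms(2)[OF S h f] .
  next
    show "Re (S f f) = nrm V f * nrm V f"
      using sqrt[OF f] sip_axioms(5)[OF S f f False]
      by (metis abs_of_pos real_sqrt_mult_self)
  qed
qed

text \<open>The formula forced by uniqueness is taken as the candidate. Conjugate homogeneity in the
  second variable is the one axiom that needs \<open>support_functional_unique\<close>.\<close>

lemma
  shows semi_inner_product_sip: "semi_inner_product V (sip V)"
    and compatible_sip: "compatible V (sip V)"
proof -
  \<comment> \<open>At \<open>f = 0\<close> the factor \<open>nrm V f\<close> cancels the
    meaningless value of \<open>ndual\<close>; the zero values off the carrier match the convention
    of \<open>sip\<close>.\<close>
  define S where "S g f = (if f \<in> points V \<and> g \<in> points V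
    then complex_of_real (nrm V f) * ndual f g else 0)" for g f
  have self: "S f f = (nrm V f)\<^sup>2" if "f \<in> points V" for f
    using that ndual_self[OF that] by (cases "f = 0") (simp_all add: S_def nrm_zero power2_eq_square)
  have dom: "cmod (S g f) \<le> nrm V g * nrm V f" if f: "f \<in> points V" and g: "g \<in> points V" for g f
    using f g cmod_ndual_le[OF f _ g] nrm_nonneg[OF f]
    by (cases "f = 0") (simp_all add: S_def nrm_zero norm_mult mult.commute mult_left_mono)
  have add: "S (f + g) h = S f h + S g h"
    if "f \<in> points V" "g \<in> points V" "h \<in> points V" for f g h
    using that add_mem ndual_add[of h f g]
    by (cases "h = 0") (simp_all add: S_def nrm_zero distrib_left)
  have scale: "S (a *\<^sub>C f) g = a * S f g" if "f \<in> points V" "g \<in> points V" for a f g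
    using that scale_mem ndual_scale[of g f] by (cases "g = 0") (simp_all add: S_def nrm_zero)
  have conj: "S f (a *\<^sub>C g) = cnj a * S f g" if f: "f \<in> points V" and g: "g \<in> points V" for a f g
  proof (cases "a = 0 \<or> g = 0")
    case True
    then show ?thesis by (auto simp: S_def nrm_zero)
  next
    case False
    have ag: "a *\<^sub>C g \<in> points V" "a *\<^sub>C g \<noteq> 0"
      using False g scale_mem complex_vector.scale_eq_0_iff by auto
    \<comment> \<open>The functional \<open>cnj a * S f g\<close> in \<open>f\<close> touches
      \<open>nrm V (a *\<^sub>C g)\<close> times the norm at \<open>a *\<^sub>C g\<close>, hence is
      the one that defines \<open>S\<close> there.\<close>
    have "cnj a * S f g = complex_of_real (nrm V (a *\<^sub>C g)) * ndual (a *\<^sub>C g) f"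
    proof (rule support_functional_unique[OF ag f, where \<phi> = "\<lambda>f. cnj a * S f g"])
      fix h assume h: "h \<in> points V"
      show "Re (cnj a * S h g) \<le> nrm V (a *\<^sub>C g) * nrm V h"
        using dom[OF g h] complex_Re_le_cmod[of "cnj a * S h g"] nrm_scale[OF g, of a]
        by (smt (verit) complex_mod_cnj mult.assoc mult.commute mult_left_mono norm_ge_zero norm_mult)
    next
      have "cnj a * S (a *\<^sub>C g) g = complex_of_real ((nrm V (a *\<^sub>C g))\<^sup>2)"
        using scale[OF g g] self[OF g] nrm_scale[OF g, of a] complex_norm_square[of a]
        by (simp add: power_mult_distrib mult.commute)
      then show "Re (cnj a * S (a *\<^sub>C g) g) = nrm V (a *\<^sub>C g) * nrm V (a *\<^sub>C g)"
        by (simp add: power2_eq_square)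
    qed (simp_all add: g add scale distrib_left)
    then show ?thesis using ag f by (simp add: S_def)
  qed
  have S: "semi_inner_product V S"
    unfolding semi_inner_product_def
    using add scale conj self dom nrm_nonneg nrm_eq_0 by (simp flip: of_real_power)
  have comp: "compatible V S"
    using self nrm_nonneg by (simp add: compatible_def)
  have "sip V = S"
    unfolding sip_def
  proof (rule the_equality)
    show "semi_inner_product V S \<and> compatible V S \<and>
        (\<forall>f g. f \<notin> points V \<or> g \<notin> points V \<longrightarrow> S f g = 0)"
      using S comp by (auto simp: S_def)
    show "T = S" if "semi_inner_product V T \<and> compatible V T \<and>
        (\<forall>f g. f \<notin> points V \<or> g \<notin> points V \<longrightarrow> T f g = 0)" for T
      using that compatible_sip_eq_ndual[of T] by (intro ext) (auto simp: S_def)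
  qed
  with S comp show "semi_inner_product V (sip V)" "compatible V (sip V)" by simp_all
qed

lemmas sip_add = sip_axioms(1)[OF semi_inner_product_sip]
  and sip_scale_left = sip_axioms(2)[OF semi_inner_product_sip]
  and sip_scale_right = sip_axioms(3)[OF semi_inner_product_sip]
  and sip_eq_ndual = compatible_sip_eq_ndual[OF semi_inner_product_sip compatible_sip]

lemma compatible_sip_unique:
  assumes "semi_inner_product V S" "compatible V S" "f \<in> points V" "g \<in> points V"
  shows "S f g = sip V f g"
  using assms compatible_sip_eq_ndual sip_eq_ndual by simp

lemma sip_self: "f \<in> points V \<Longrightarrow> sip V f f = complex_of_real ((nrm V f)\<^sup>2)"
  using sip_eq_ndual[of f f] ndual_self[of f]
  by (cases "f = 0") (simp_all add: nrm_zero power2_eq_square)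

lemma cmod_sip_le:
  assumes "f \<in> points V" "g \<in> points V"
  shows "cmod (sip V f g) \<le> nrm V f * nrm V g"
  using sip_axioms(6)[OF semi_inner_product_sip assms] compatible_sip assms
  by (simp add: compatible_def)

lemma sip_zero_right: "f \<in> points V \<Longrightarrow> sip V f 0 = 0"
  using sip_scale_right[of f f 0] by simp

end

section \<open>Representation of functionals and the generalized adjoint\<close>

locale uniform_points =
  fixes V :: "'a::complex_vector space"
  assumes uniform: "uniform_space V"

sublocale uniform_points \<subseteq> smooth_points
  using uniform by unfold_locales (auto simp: uniform_space_def banach_space_def)

context uniform_points
begin

lemma convexity:
  assumes "0 < e"
  obtains d where "0 < d"
    "\<And>f g. f \<in> unit_sphere V \<Longrightarrow> g \<in> unit_sphere V \<Longrightarrow> e \<le> nrm V (f - g) \<Longrightarrow> nrm V (f + g) \<le> 2 - d"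
  using uniform assms unfolding uniform_space_def uniformly_convex_def by metis

lemma complete:
  fixes x :: "nat \<Rightarrow> 'a"
  assumes "\<And>n. x n \<in> points V" "\<And>e. e > 0 \<Longrightarrow> \<exists>N. \<forall>m\<ge>N. \<forall>n\<ge>N. nrm V (x m - x n) < e"
  obtains l where "l \<in> points V" "\<And>e. e > 0 \<Longrightarrow> \<exists>N. \<forall>n\<ge>N. nrm V (x n - l) < e"
proof -
  have "Metric_space.mcomplete (points V) (ndist V)"
    using uniform by (simp add: uniform_space_def banach_space_def)
  then show ?thesis using that assms unfolding mcomplete_iff by blast
qed

text \<open>Injectivity of the duality mapping. Equal functionals force a common norm
  \<open>r\<close> and \<open>sip V (f + g) f = 2 * r\<^sup>2\<close>, so \<open>f + g\<close> has
  norm at least \<open>2 * r\<close>; for distinct \<open>f\<close> and \<open>g\<close> uniform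
  convexity forbids this.\<close>

lemma sip_right_cancel:
  assumes f: "f \<in> points V" and g: "g \<in> points V"
    and eq: "\<And>h. h \<in> points V \<Longrightarrow> sip V h f = sip V h g"
  shows "f = g"
proof (rule ccontr)
  assume "f \<noteq> g"
  \<comment> \<open>Cauchy-Schwarz for \<open>sip V f g = sip V f f\<close>; used in both
    directions.\<close>
  have le: "nrm V f \<le> nrm V g" if "f \<in> points V" "g \<in> points V"
    "\<And>h. h \<in> points V \<Longrightarrow> sip V h f = sip V h g" for f g
  proof (cases "f = 0")
    case False
    have "cmod (sip V f f) = (nrm V f)\<^sup>2" using sip_self[OF that(1)] by (simp add: norm_power)
    then have "(nrm V f)\<^sup>2 \<le> nrm V f * nrm V g"
      using cmod_sip_le[OF that(1,2)] that(3)[OF that(1)] by simp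
    then show ?thesis using nrm_pos[OF that(1) False] by (simp add: power2_eq_square)
  qed (use that nrm_nonneg nrm_zero in auto)
  define r where "r = nrm V f"
  have r: "nrm V g = r" using le[OF f g eq] le[OF g f eq[symmetric]] by (simp add: r_def)
  have "r > 0" using \<open>f \<noteq> g\<close> nrm_pos[OF f] nrm_eq_0[OF g] nrm_zero r r_def by (cases "f = 0") auto
  have "sip V (f + g) f = complex_of_real (2 * r\<^sup>2)"
    using sip_add[OF f f g] eq[OF g] sip_self[OF f] sip_self[OF g] r r_def by simp
  then have "2 * r\<^sup>2 \<le> nrm V (f + g) * r"
    using cmod_sip_le[OF add_mem[OF f g] f] by (simp add: r_def norm_mult norm_power)
  then have ge: "2 * r \<le> nrm V (f + g)" using \<open>r > 0\<close> by (simp add: power2_eq_square)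
  let ?s = "\<lambda>f. complex_of_real (1 / r) *\<^sub>C f"
  have pos: "0 < nrm V (f - g) / r"
    using nrm_pos[OF diff_mem[OF f g]] \<open>f \<noteq> g\<close> \<open>r > 0\<close> by simp
  obtain d where d: "d > 0" "\<And>p q. p \<in> unit_sphere V \<Longrightarrow> q \<in> unit_sphere V \<Longrightarrow>
      nrm V (f - g) / r \<le> nrm V (p - q) \<Longrightarrow> nrm V (p + q) \<le> 2 - d"
    using convexity[OF pos] by metis
  have nrm_s: "nrm V (?s h) = nrm V h / r" if "h \<in> points V" for h
    using nrm_scale[OF that] \<open>r > 0\<close> by (simp add: norm_divide)
  have "?s f \<in> unit_sphere V" "?s g \<in> unit_sphere V"
    using nrm_s f g r \<open>r > 0\<close> scale_mem by (auto simp: unit_sphere_def r_def)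
  moreover have "nrm V (f - g) / r \<le> nrm V (?s f - ?s g)"
    using nrm_s[OF diff_mem[OF f g]] by (simp add: complex_vector.scale_right_diff_distrib)
  ultimately have "nrm V (?s f + ?s g) \<le> 2 - d" by (rule d(2))
  then have "nrm V (f + g) / r \<le> 2 - d"
    using nrm_s[OF add_mem[OF f g]] by (simp add: scaleC_add_right)
  moreover have "2 \<le> nrm V (f + g) / r" using ge \<open>r > 0\<close> by (simp add: field_simps)
  ultimately show False using d(1) by simp
qed

text \<open>By uniform convexity a maximizing sequence on the unit sphere is Cauchy; at its limit the
  functional touches a multiple of the norm.\<close>

lemma sip_represents:
  assumes add: "\<And>g h. g \<in> points V \<Longrightarrow> h \<in> points V \<Longrightarrow> \<phi> (g + h) = \<phi> g + \<phi> h"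
    and scale: "\<And>a g. g \<in> points V \<Longrightarrow> \<phi> (a *\<^sub>C g) = a * \<phi> g"
    and bound: "\<And>g. g \<in> points V \<Longrightarrow> cmod (\<phi> g) \<le> C * nrm V g"
  obtains v where "v \<in> points V" "\<And>g. g \<in> points V \<Longrightarrow> \<phi> g = sip V g v"
\<comment> \<open>The zero functional is set apart: the supremum below must be positive and the unit
  sphere nonempty.\<close>
proof (cases "\<forall>g\<in>points V. \<phi> g = 0")
  case True
  then show ?thesis using that[OF zero_mem] sip_zero_right by simp
next
  case False
  then obtain g where g: "g \<in> points V" "\<phi> g \<noteq> 0" by blast
  \<comment> \<open>\<open>M\<close> is the norm of \<phi>, computed from real parts; rotating
    \<open>g\<close> below shows that it is positive.\<close>
  define M where "M = (SUP s\<in>unit_sphere V. Re (\<phi> s))"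
  have normalize: "complex_of_real (1 / nrm V h) *\<^sub>C h \<in> unit_sphere V"
    if "h \<in> points V" "h \<noteq> 0" for h
    using that nrm_pos[OF that] nrm_scale[OF that(1)] scale_mem
    by (simp add: unit_sphere_def norm_divide)
  have zero: "\<phi> 0 = 0" using scale[OF zero_mem, of 0] by simp
  have bdd: "bdd_above ((\<lambda>s. Re (\<phi> s)) ` unit_sphere V)"
    using bound complex_Re_le_cmod order_trans
    by (intro bdd_aboveI2[of _ _ C]) (fastforce simp: unit_sphere_def)
  have le: "Re (\<phi> h) \<le> M * nrm V h" if h: "h \<in> points V" for h
  proof (cases "h = 0")
    case False
    have "Re (\<phi> (complex_of_real (1 / nrm V h) *\<^sub>C h)) \<le> M"
      unfolding M_def by (rule cSUP_upper[OF normalize[OF h False] bdd])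
    then show ?thesis using scale[OF h] nrm_pos[OF h False] by (simp add: field_simps)
  qed (simp add: zero nrm_zero)
  obtain u where u: "cmod u = 1" "u * \<phi> g = cmod (\<phi> g)" by (rule unimodular_rotation)
  have "0 < Re (\<phi> (u *\<^sub>C g))" using scale[OF g(1), of u] u g(2) by simp
  moreover have "\<dots> \<le> M * nrm V g" using le[OF scale_mem[OF g(1)], of u] nrm_scale[OF g(1)] u(1) by simp
  ultimately have M: "M > 0"
    using nrm_nonneg[OF g(1)] by (metis less_le_trans zero_less_mult_pos2 mult_nonpos_nonneg not_le)
  have "g \<noteq> 0" using g zero by auto
  then have nonempty: "unit_sphere V \<noteq> {}" using normalize g(1) by blast
  have "\<exists>s\<in>unit_sphere V. M - inverse (Suc k) < Re (\<phi> s)" for k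
    using less_cSUP_iff[OF nonempty bdd, of "M - inverse (Suc k)"] by (simp flip: M_def)
  then obtain x where x: "\<And>k. x k \<in> unit_sphere V" "\<And>k. M - inverse (Suc k) < Re (\<phi> (x k))"
    by metis
  then have xV: "x k \<in> points V" and x1: "nrm V (x k) = 1" for k
    by (auto simp: unit_sphere_def)
  have close: "M - inverse (Suc N) < Re (\<phi> (x m))" if "N \<le> m" for N m
  proof -
    have "inverse (real (Suc m)) \<le> inverse (real (Suc N))" using that by (intro le_imp_inverse_le) auto
    with x(2)[of m] show ?thesis by linarith
  qed
  have cauchy: "\<exists>N. \<forall>m\<ge>N. \<forall>n\<ge>N. nrm V (x m - x n) < e" if e: "e > 0" for e
  proof -
    obtain d where d: "d > 0"
      "\<And>f g. f \<in> unit_sphere V \<Longrightarrow> g \<in> unit_sphere V \<Longrightarrow> e \<le> nrm V (f - g) \<Longrightarrow> nrm V (f + g) \<le> 2 - d"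
      using convexity[OF e] by metis
    \<comment> \<open>Past \<open>N\<close> the real parts at \<open>x m\<close> and
      \<open>x n\<close> sum to more than \<open>M * (2 - d)\<close>, while a gap of at least
      \<open>e\<close> would bound this sum by \<open>M * (2 - d)\<close>.\<close>
    obtain N where N: "inverse (real (Suc N)) < M * d / 2"
      using reals_Archimedean[of "M * d / 2"] M d(1) by auto
    have "nrm V (x m - x n) < e" if "m \<ge> N" "n \<ge> N" for m n
    proof (rule ccontr)
      assume "\<not> nrm V (x m - x n) < e"
      then have "M * nrm V (x m + x n) \<le> M * (2 - d)" using d(2)[of "x m" "x n"] x M by simp
      then show False
        using le[OF add_mem[OF xV xV], of m n] add[OF xV xV, of m n] close[OF that(1)] close[OF that(2)] N
        by (simp add: algebra_simps)
    qed
    then show ?thesis by blast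
  qed
  obtain l where l: "l \<in> points V" "\<And>e. e > 0 \<Longrightarrow> \<exists>N. \<forall>n\<ge>N. nrm V (x n - l) < e"
    using complete[of x, OF xV cauchy] by metis
  \<comment> \<open>The reverse triangle inequality along \<open>x n\<close>; the summand
    \<open>0\<close> fits \<open>field_le_epsilon\<close>.\<close>
  have "\<bar>1 - nrm V l\<bar> \<le> 0 + e" if "e > 0" for e
    using l(2)[OF that] nrm_diff_le[OF xV l(1)] x1 by (metis add_0 le_refl less_le_trans less_imp_le order_trans)
  then have l1: "nrm V l = 1" using field_le_epsilon[of "\<bar>1 - nrm V l\<bar>" 0] by auto
  have "M \<le> Re (\<phi> l) + e" if e: "e > 0" for e
  proof -
    obtain N where N: "inverse (real (Suc N)) < e / 2" using reals_Archimedean[of "e / 2"] e by auto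
    obtain N' where N': "\<forall>n\<ge>N'. nrm V (x n - l) < e / (2 * M)" using l(2)[of "e / (2 * M)"] e M by auto
    define n where "n = max N N'"
    have "M * nrm V (x n - l) < e / 2" using N' M by (simp add: n_def field_simps)
    then have "Re (\<phi> (x n - l)) < e / 2" using le[OF diff_mem[OF xV l(1)], of n] by simp
    moreover have "\<phi> (x n) = \<phi> (x n - l) + \<phi> l" using add[OF diff_mem[OF xV l(1)] l(1), of n] by simp
    ultimately show ?thesis using close[of N n] N by (simp add: n_def)
  qed
  then have "M \<le> Re (\<phi> l)" by (rule field_le_epsilon)
  then have touch: "Re (\<phi> l) = M * nrm V l" using le[OF l(1)] l1 by simp
  have "l \<noteq> 0" using l1 nrm_zero by auto
  show ?thesis
  \<comment> \<open>The representing vector is \<open>M\<close> times the maximizer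
    \<open>l\<close>, because the duality mapping is conjugate homogeneous and \<open>l\<close> has
    norm \<open>1\<close>.\<close>
  proof (rule that[OF scale_mem[OF l(1), of "complex_of_real M"]])
    fix h assume h: "h \<in> points V"
    have "\<phi> h = M * ndual l h"
      by (rule support_functional_unique[OF l(1) \<open>l \<noteq> 0\<close> h add scale le touch])
    also have "\<dots> = sip V h (complex_of_real M *\<^sub>C l)"
      using sip_scale_right[OF h l(1)] sip_eq_ndual[OF l(1) h] l1 by simp
    finally show "\<phi> h = sip V h (complex_of_real M *\<^sub>C l)" .
  qed
qed

end

section \<open>Existence and uniqueness of the generalized adjoint\<close>

lemma lin_mapsD:
  assumes "T \<in> lin_maps V W"
  shows "u \<in> points V \<Longrightarrow> T u \<in> points W"
    and "u \<notin> points V \<Longrightarrow> T u = 0"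
    and "u \<in> points V \<Longrightarrow> v \<in> points V \<Longrightarrow> T (u + v) = T u + T v"
    and "u \<in> points V \<Longrightarrow> T (a *\<^sub>C u) = a *\<^sub>C T u"
    and "\<exists>\<alpha>\<ge>0. \<forall>u\<in>points V. nrm W (T u) \<le> \<alpha> * nrm V u"
  using assms by (auto simp: lin_maps_def bdd_maps_def funs_def)

text \<open>For fixed \<open>v\<close> the functional \<open>\<lambda>u. sip W (T u) v\<close> is
  bounded, and its representing vector is the value of the adjoint at \<open>v\<close>.
  \<open>sip_right_cancel\<close> makes this vector unique, so the description by \<open>THE\<close>
  is met.\<close>

lemma
  fixes V :: "'a::complex_vector space" and W :: "'b::complex_vector space"
  assumes "uniform_space V" "uniform_space W" and T: "T \<in> lin_maps V W"
  shows gadj_bdd_maps: "gadj V W T \<in> bdd_maps W V"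
    and sip_gadj: "u \<in> points V \<Longrightarrow> v \<in> points W \<Longrightarrow> sip W (T u) v = sip V u (gadj V W T v)"
proof -
  interpret V: uniform_points V by unfold_locales fact
  interpret W: uniform_points W by unfold_locales fact
  obtain \<alpha> where \<alpha>: "\<alpha> \<ge> 0" "\<And>u. u \<in> points V \<Longrightarrow> nrm W (T u) \<le> \<alpha> * nrm V u"
    using lin_mapsD(5)[OF T] by blast
  have "\<exists>w\<in>points V. \<forall>u\<in>points V. sip W (T u) v = sip V u w" if v: "v \<in> points W" for v
  proof (rule V.sip_represents[where \<phi> = "\<lambda>u. sip W (T u) v" and C = "\<alpha> * nrm W v"])
    show "cmod (sip W (T u) v) \<le> \<alpha> * nrm W v * nrm V u" if "u \<in> points V" for u
      using W.cmod_sip_le[OF lin_mapsD(1)[OF T that] v]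
        mult_right_mono[OF \<alpha>(2)[OF that] W.nrm_nonneg[OF v]] by (simp add: mult_ac)
  qed (use v lin_mapsD[OF T] W.sip_add W.sip_scale_left in auto)
  then obtain R where R: "\<And>v. v \<in> points W \<Longrightarrow> R v \<in> points V"
    "\<And>u v. u \<in> points V \<Longrightarrow> v \<in> points W \<Longrightarrow> sip W (T u) v = sip V u (R v)"
    by metis
  \<comment> \<open>\<open>R\<close> is arbitrary off the carrier, whereas members of
    \<open>bdd_maps\<close> vanish there.\<close>
  define S where "S = extend0 (points W) R"
  have bound: "nrm V (R v) \<le> \<alpha> * nrm W v" if v: "v \<in> points W" for v
  proof (cases "R v = 0")
    case False
    \<comment> \<open>The defining identity tested at \<open>u = R v\<close>.\<close>
    have "(nrm V (R v))\<^sup>2 = cmod (sip W (T (R v)) v)"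
      using R that V.sip_self by (simp add: norm_power)
    also have "\<dots> \<le> \<alpha> * nrm V (R v) * nrm W v"
      using W.cmod_sip_le[OF lin_mapsD(1)[OF T R(1)[OF v]] v]
        mult_right_mono[OF \<alpha>(2)[OF R(1)[OF v]] W.nrm_nonneg[OF v]] by simp
    finally show ?thesis using V.nrm_pos[OF R(1)[OF v] False] by (simp add: power2_eq_square mult_ac)
  qed (use \<alpha> V.nrm_zero W.nrm_nonneg[OF v] in auto)
  have S: "S \<in> bdd_maps W V \<and> (\<forall>u\<in>points V. \<forall>v\<in>points W. sip W (T u) v = sip V u (S v))"
    using R bound \<alpha>(1) by (auto simp: bdd_maps_def funs_def S_def extend0_def)
  have "gadj V W T = S"
    unfolding gadj_def
  proof (rule the_equality)
    show "S \<in> bdd_maps W V \<and> (\<forall>u\<in>points V. \<forall>v\<in>points W. sip W (T u) v = sip V u (S v))" by (fact S)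
    fix S' assume S': "S' \<in> bdd_maps W V \<and> (\<forall>u\<in>points V. \<forall>v\<in>points W. sip W (T u) v = sip V u (S' v))"
    show "S' = S"
    proof
      fix v
      show "S' v = S v"
      proof (cases "v \<in> points W")
        case True
        then show ?thesis using S S' by (intro V.sip_right_cancel) (auto simp: bdd_maps_def funs_def)
      qed (use S S' in \<open>auto simp: bdd_maps_def funs_def\<close>)
    qed
  qed
  with S show "gadj V W T \<in> bdd_maps W V"
    and "u \<in> points V \<Longrightarrow> v \<in> points W \<Longrightarrow> sip W (T u) v = sip V u (gadj V W T v)"
    by auto
qed


section \<open>The dual space\<close>

context normed_points
begin

lemma dual_pointsD:
  assumes "\<phi> \<in> points (dual V)"
  shows "f \<notin> points V \<Longrightarrow> \<phi> f = 0"
    and "f \<in> points V \<Longrightarrow> g \<in> points V \<Longrightarrow> \<phi> (f + g) = \<phi> f + \<phi> g"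
    and "f \<in> points V \<Longrightarrow> \<phi> (a *\<^sub>C f) = a * \<phi> f"
    and "\<exists>\<alpha>\<ge>0. \<forall>f\<in>points V. cmod (\<phi> f) \<le> \<alpha> * nrm V f"
  using lin_mapsD[of \<phi> V scalars] assms by (simp_all add: dual_def scalars_def scaleC_complex_def)

lemma dual_pointsI:
  assumes "\<And>f. f \<notin> points V \<Longrightarrow> \<phi> f = 0"
    and "\<And>f g. f \<in> points V \<Longrightarrow> g \<in> points V \<Longrightarrow> \<phi> (f + g) = \<phi> f + \<phi> g"
    and "\<And>a f. f \<in> points V \<Longrightarrow> \<phi> (a *\<^sub>C f) = a * \<phi> f"
    and "0 \<le> \<alpha>" "\<And>f. f \<in> points V \<Longrightarrow> cmod (\<phi> f) \<le> \<alpha> * nrm V f"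
  shows "\<phi> \<in> points (dual V)"
  using assms by (auto simp: dual_def lin_maps_def bdd_maps_def funs_def scalars_def scaleC_complex_def)

lemma dual_nrm_upper:
  assumes \<phi>: "\<phi> \<in> points (dual V)" and f: "f \<in> points V"
  shows "cmod (\<phi> f) \<le> nrm (dual V) \<phi> * nrm V f"
proof (cases "f = 0")
  case True
  then show ?thesis using dual_pointsD(3)[OF \<phi> zero_mem, of 0] by (simp add: nrm_zero)
next
  case False
  define r where "r = nrm V f"
  have r: "r > 0" using nrm_pos[OF f False] by (simp add: r_def)
  obtain \<alpha> where \<alpha>: "\<alpha> \<ge> 0" "\<And>f. f \<in> points V \<Longrightarrow> cmod (\<phi> f) \<le> \<alpha> * nrm V f"
    using dual_pointsD(4)[OF \<phi>] by blast
  have "cmod (\<phi> g) \<le> \<alpha>" if "g \<in> points V" "nrm V g \<le> 1" for g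
    using \<alpha>(2)[OF that(1)] mult_left_mono[OF that(2) \<alpha>(1)] by simp
  \<comment> \<open>A real supremum is an upper bound only for a set that is bounded above.\<close>
  then have bdd: "bdd_above ((\<lambda>g. cmod (\<phi> g)) ` {g \<in> points V. nrm V g \<le> 1})"
    by (intro bdd_aboveI2[of _ _ \<alpha>]) auto
  have "complex_of_real (1 / r) *\<^sub>C f \<in> {g \<in> points V. nrm V g \<le> 1}"
    using scale_mem[OF f] nrm_scale[OF f] r by (simp add: norm_divide flip: r_def)
  then have "cmod (\<phi> (complex_of_real (1 / r) *\<^sub>C f)) \<le> nrm (dual V) \<phi>"
    using cSUP_upper[OF _ bdd] by (simp add: dual_def)
  then show ?thesis
    using dual_pointsD(3)[OF \<phi> f] r by (simp add: norm_mult norm_divide field_simps flip: r_def)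
qed

lemma dual_nrm_least:
  assumes "0 \<le> c" "\<And>f. f \<in> points V \<Longrightarrow> cmod (\<phi> f) \<le> c * nrm V f"
  shows "nrm (dual V) \<phi> \<le> c"
proof -
  have "cmod (\<phi> f) \<le> c" if "f \<in> points V" "nrm V f \<le> 1" for f
    using assms(2)[OF that(1)] mult_left_mono[OF that(2) assms(1)] by simp
  moreover have "{f \<in> points V. nrm V f \<le> 1} \<noteq> {}" using zero_mem nrm_zero by force
  ultimately show ?thesis by (auto simp: dual_def intro!: cSUP_least)
qed

lemma dual_nrm_nonneg:
  assumes \<phi>: "\<phi> \<in> points (dual V)"
  shows "0 \<le> nrm (dual V) \<phi>"
proof (cases "\<exists>f\<in>points V. f \<noteq> 0")
  case True
  then obtain f where f: "f \<in> points V" "f \<noteq> 0" by blast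
  have "0 \<le> nrm (dual V) \<phi> * nrm V f" using dual_nrm_upper[OF \<phi> f(1)] norm_ge_zero order_trans by blast
  then show ?thesis using nrm_pos[OF f] by (simp add: zero_le_mult_iff)
next
  case False
  then have "{f \<in> points V. nrm V f \<le> 1} = {0}" using zero_mem nrm_zero by auto
  then show ?thesis by (simp add: dual_def)
qed

lemma csubspace_dual: "csubspace (points (dual V))"
proof (rule complex_vector.subspaceI)
  show "0 \<in> points (dual V)"
    by (rule dual_pointsI[where \<alpha> = 0]) auto
  show "\<phi> + \<psi> \<in> points (dual V)" if \<phi>: "\<phi> \<in> points (dual V)" and \<psi>: "\<psi> \<in> points (dual V)" for \<phi> \<psi>
  proof (rule dual_pointsI[where \<alpha> = "nrm (dual V) \<phi> + nrm (dual V) \<psi>"])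
    show "cmod ((\<phi> + \<psi>) f) \<le> (nrm (dual V) \<phi> + nrm (dual V) \<psi>) * nrm V f" if "f \<in> points V" for f
      using dual_nrm_upper[OF \<phi> that] dual_nrm_upper[OF \<psi> that] norm_triangle_ineq[of "\<phi> f" "\<psi> f"]
      by (simp add: distrib_right)
  qed (use dual_pointsD[OF \<phi>] dual_pointsD[OF \<psi>] dual_nrm_nonneg[OF \<phi>] dual_nrm_nonneg[OF \<psi>]
      in \<open>simp_all add: algebra_simps\<close>)
  show "c *\<^sub>C \<phi> \<in> points (dual V)" if \<phi>: "\<phi> \<in> points (dual V)" for c \<phi>
  proof (rule dual_pointsI[where \<alpha> = "cmod c * nrm (dual V) \<phi>"])
    show "cmod ((c *\<^sub>C \<phi>) f) \<le> cmod c * nrm (dual V) \<phi> * nrm V f" if "f \<in> points V" for f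
      using mult_left_mono[OF dual_nrm_upper[OF \<phi> that], of "cmod c"]
      by (simp add: scaleC_fun_def scaleC_complex_def norm_mult mult.assoc)
  qed (use dual_pointsD[OF \<phi>] dual_nrm_nonneg[OF \<phi>]
      in \<open>simp_all add: scaleC_fun_def scaleC_complex_def algebra_simps\<close>)
qed

lemma complex_normed_space_dual: "complex_normed_space (dual V)"
proof -
  note scale = complex_vector.subspace_scale[OF csubspace_dual]
  have zero: "nrm (dual V) \<phi> = 0 \<longleftrightarrow> \<phi> = 0" if \<phi>: "\<phi> \<in> points (dual V)" for \<phi>
  proof
    assume "nrm (dual V) \<phi> = 0"
    then have "\<phi> f = 0" for f
      using dual_nrm_upper[OF \<phi>, of f] dual_pointsD(1)[OF \<phi>, of f] by (cases "f \<in> points V") auto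
    then show "\<phi> = 0" by auto
  next
    assume "\<phi> = 0"
    then show "nrm (dual V) \<phi> = 0"
      using dual_nrm_least[of 0 \<phi>] dual_nrm_nonneg[OF \<phi>] by simp
  qed
  have le: "nrm (dual V) (a *\<^sub>C \<phi>) \<le> cmod a * nrm (dual V) \<phi>" if \<phi>: "\<phi> \<in> points (dual V)" for a \<phi>
  proof (rule dual_nrm_least)
    show "cmod ((a *\<^sub>C \<phi>) f) \<le> cmod a * nrm (dual V) \<phi> * nrm V f" if "f \<in> points V" for f
      using mult_left_mono[OF dual_nrm_upper[OF \<phi> that], of "cmod a"]
      by (simp add: scaleC_fun_def scaleC_complex_def norm_mult mult.assoc)
  qed (simp add: dual_nrm_nonneg[OF \<phi>])
  \<comment> \<open>The reverse inequality is \<open>le\<close> for the scalar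
    \<open>inverse a\<close> and the functional \<open>a *\<^sub>C \<phi>\<close>.\<close>
  have "cmod a * nrm (dual V) \<phi> \<le> nrm (dual V) (a *\<^sub>C \<phi>)" if \<phi>: "\<phi> \<in> points (dual V)" for a \<phi>
  proof (cases "a = 0")
    case False
    have "inverse a *\<^sub>C a *\<^sub>C \<phi> = \<phi>" using False by (simp add: scaleC_scaleC scaleC_one)
    then have "nrm (dual V) \<phi> \<le> nrm (dual V) (a *\<^sub>C \<phi>) / cmod a"
      using le[OF scale[OF \<phi>], of "inverse a" a] by (simp add: norm_inverse divide_inverse mult.commute)
    then show ?thesis using False by (simp add: pos_le_divide_eq mult.commute)
  qed (use dual_nrm_nonneg[OF scale[OF \<phi>, of 0]] in simp)
  moreover have "nrm (dual V) (\<phi> + \<psi>) \<le> nrm (dual V) \<phi> + nrm (dual V) \<psi>"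
    if \<phi>: "\<phi> \<in> points (dual V)" and \<psi>: "\<psi> \<in> points (dual V)" for \<phi> \<psi>
  proof (rule dual_nrm_least)
    show "cmod ((\<phi> + \<psi>) f) \<le> (nrm (dual V) \<phi> + nrm (dual V) \<psi>) * nrm V f" if "f \<in> points V" for f
      using dual_nrm_upper[OF \<phi> that] dual_nrm_upper[OF \<psi> that] norm_triangle_ineq[of "\<phi> f" "\<psi> f"]
      by (simp add: distrib_right)
  qed (simp add: dual_nrm_nonneg \<phi> \<psi>)
  ultimately show ?thesis
    unfolding complex_normed_space_def
    using csubspace_dual dual_nrm_nonneg zero le by (auto intro: antisym)
qed

end

section \<open>The duality map and the density condition\<close>

context uniform_points
begin

lemma duality_map_in_dual:
  assumes f: "f \<in> points V"
  shows "duality_map V f \<in> points (dual V)"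
proof (rule dual_pointsI[where \<alpha> = "nrm V f"])
  show "cmod (duality_map V f g) \<le> nrm V f * nrm V g" if "g \<in> points V" for g
    using cmod_sip_le[OF that f] that by (simp add: duality_map_def extend0_def mult.commute)
qed (use f add_mem scale_mem sip_add sip_scale_left nrm_nonneg
    in \<open>simp_all add: duality_map_def extend0_def\<close>)

text \<open>Approximate \<open>u\<^sup>*\<close> by functionals annihilating \<open>u\<close>.\<close>

lemma dense_annihilator_eq_0:
  assumes dense: "ntop (dual V) closure_of cspan A = points (dual V)"
    and u: "u \<in> points V" and ann: "\<And>\<phi>. \<phi> \<in> A \<Longrightarrow> \<phi> u = 0"
  shows "u = 0"
proof (rule ccontr)
  assume "u \<noteq> 0"
  then have pos: "nrm V u > 0" by (rule nrm_pos[OF u])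
  interpret dual: Metric_space "points (dual V)" "ndist (dual V)"
    by (rule Metric_space_ndist[OF complex_normed_space_dual])
  \<comment> \<open>Vanishing at \<open>u\<close> passes to linear combinations, hence to the whole
    span.\<close>
  have "csubspace {\<phi>. \<phi> u = (0::complex)}"
    by (rule complex_vector.subspaceI) (auto simp: scaleC_fun_def scaleC_complex_def)
  then have span: "cspan A \<subseteq> {\<phi>. \<phi> u = 0}"
    using ann by (intro complex_vector.span_minimal) auto
  have "duality_map V u \<in> dual.mtopology closure_of cspan A"
    using dense duality_map_in_dual[OF u] by simp
  then obtain \<phi> where \<phi>: "\<phi> \<in> cspan A" "\<phi> \<in> dual.mball (duality_map V u) (nrm V u)"
    unfolding dual.metric_closure_of using pos by blast
  then have mem: "\<phi> \<in> points (dual V)" "duality_map V u \<in> points (dual V)"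
    and near: "nrm (dual V) (duality_map V u - \<phi>) < nrm V u"
    by (auto simp: ndist_def)
  \<comment> \<open>Since \<phi> annihilates \<open>u\<close>, evaluating the difference at
    \<open>u\<close> gives the full square, yet the difference has norm below
    \<open>nrm V u\<close>.\<close>
  have "(nrm V u)\<^sup>2 = cmod ((duality_map V u - \<phi>) u)"
    using \<phi>(1) span u sip_self[OF u] by (auto simp: duality_map_def extend0_def norm_power)
  also have "\<dots> \<le> nrm (dual V) (duality_map V u - \<phi>) * nrm V u"
    by (rule dual_nrm_upper[OF complex_vector.subspace_diff[OF csubspace_dual mem(2,1)] u])
  also have "\<dots> < (nrm V u)\<^sup>2" using near pos by (simp add: power2_eq_square)
  finally show False by simp
qed

end

section \<open>Transport along linear isometries\<close>

text \<open>\<open>B\<close> starts with a bare norm function; its norm axioms, completeness and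
  geometry are derived from those of \<open>V\<close> through \<open>J\<close>.\<close>

locale isometric_image = normed_points V
  for V :: "'a::complex_vector space" +
  fixes B :: "'b::complex_vector space" and J :: "'a \<Rightarrow> 'b"
  assumes points_B: "points B = J ` points V"
    and nrm_J: "u \<in> points V \<Longrightarrow> nrm B (J u) = nrm V u"
    and J_add: "u \<in> points V \<Longrightarrow> v \<in> points V \<Longrightarrow> J (u + v) = J u + J v"
    and J_scale: "u \<in> points V \<Longrightarrow> J (a *\<^sub>C u) = a *\<^sub>C J u"
begin

lemma J_zero: "J 0 = 0"
  using J_scale[OF zero_mem, of 0] by simp

lemma J_diff: "u \<in> points V \<Longrightarrow> v \<in> points V \<Longrightarrow> J (u - v) = J u - J v"
  using J_add[OF diff_mem, of u v v] by (simp add: eq_diff_eq)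

lemma J_eq_iff:
  assumes "u \<in> points V" "v \<in> points V"
  shows "J u = J v \<longleftrightarrow> u = v"
proof
  assume "J u = J v"
  then have "nrm B (J (u - v)) = nrm B (J 0)" using J_diff assms J_zero by simp
  then show "u = v" using nrm_J diff_mem assms zero_mem nrm_eq_0 nrm_zero by simp
qed simp

lemma complex_normed_space_image: "complex_normed_space B"
proof -
  have J0: "J u = 0 \<longleftrightarrow> u = 0" if "u \<in> points V" for u
    using J_eq_iff[OF that zero_mem] J_zero by simp
  have "csubspace (points B)"
    unfolding points_B
  proof (rule complex_vector.subspaceI)
    show "0 \<in> J ` points V" using J_zero zero_mem by force
  qed (auto simp flip: J_add J_scale intro: add_mem scale_mem)
  then show ?thesis
    unfolding complex_normed_space_def
    by (auto simp: points_B nrm_J J0 nrm_nonneg nrm_eq_0 nrm_scale nrm_triangle add_mem scale_mem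
        simp flip: J_add J_scale)
qed

end

sublocale isometric_image \<subseteq> image: normed_points B
  by unfold_locales (rule complex_normed_space_image)

context isometric_image
begin

lemma unit_sphere_image: "unit_sphere B = J ` unit_sphere V"
  by (auto simp: unit_sphere_def points_B nrm_J)

lemma mcomplete_image:
  assumes "Metric_space.mcomplete (points V) (ndist V)"
  shows "Metric_space.mcomplete (points B) (ndist B)"
  unfolding image.mcomplete_iff
proof (intro allI impI)
  fix y :: "nat \<Rightarrow> 'b"
  assume y: "(\<forall>n. y n \<in> points B) \<and> (\<forall>e>0. \<exists>N. \<forall>m\<ge>N. \<forall>n\<ge>N. nrm B (y m - y n) < e)"
  then obtain x where x: "\<And>n. x n \<in> points V" "\<And>n. y n = J (x n)"
    unfolding points_B image_iff by metis
  have "nrm B (J u - J v) = nrm V (u - v)" if "u \<in> points V" "v \<in> points V" for u v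
    using that nrm_J diff_mem by (simp flip: J_diff)
  then have dist: "nrm B (y n - J u) = nrm V (x n - u)" if "u \<in> points V" for n u
    using x that by simp
  then have "\<forall>e>0. \<exists>N. \<forall>m\<ge>N. \<forall>n\<ge>N. nrm V (x m - x n) < e" using y x by simp
  then obtain l where l: "l \<in> points V" "\<forall>e>0. \<exists>N. \<forall>n\<ge>N. nrm V (x n - l) < e"
    using assms x(1) unfolding mcomplete_iff by blast
  then show "\<exists>l\<in>points B. \<forall>e>0. \<exists>N. \<forall>n\<ge>N. nrm B (y n - l) < e"
    using dist by (auto simp: points_B)
qed

lemma uniformly_convex_image:
  assumes "uniformly_convex V"
  shows "uniformly_convex B"
proof -
  have "nrm B (J f - J g) = nrm V (f - g)" "nrm B (J f + J g) = nrm V (f + g)"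
    if "f \<in> unit_sphere V" "g \<in> unit_sphere V" for f g
    using that nrm_J diff_mem add_mem by (simp_all add: unit_sphere_def flip: J_diff J_add)
  then show ?thesis
    using assms unfolding uniformly_convex_def unit_sphere_image by (simp add: ball_simps)
qed

lemma uniformly_frechet_differentiable_image:
  assumes "uniformly_frechet_differentiable V"
  shows "uniformly_frechet_differentiable B"
proof -
  obtain D where D: "uniform_limit (unit_sphere V \<times> unit_sphere V)
      (\<lambda>t (f, g). (nrm V (f + complex_of_real t *\<^sub>C g) - nrm V f) / t) D (at (0::real))"
    using assms by (auto simp: uniformly_frechet_differentiable_def)
  \<comment> \<open>The limit function on \<open>B\<close> is \<open>D\<close> read through the
    inverse of \<open>J\<close>.\<close>
  define I where "I = inv_into (points V) J"
  have I: "I (J f) = f" if "f \<in> points V" for f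
    using that J_eq_iff by (auto simp: I_def inj_on_def intro!: inv_into_f_f)
  have "nrm B (J f + complex_of_real t *\<^sub>C J g) = nrm V (f + complex_of_real t *\<^sub>C g)"
    if "f \<in> points V" "g \<in> points V" for f g t
    using that nrm_J add_mem scale_mem by (simp flip: J_add J_scale)
  then have "uniform_limit (unit_sphere B \<times> unit_sphere B)
      (\<lambda>t (f, g). (nrm B (f + complex_of_real t *\<^sub>C g) - nrm B f) / t) (\<lambda>(f, g). D (I f, I g)) (at (0::real))"
    using D I nrm_J unfolding uniform_limit_iff unit_sphere_image
    by (auto simp: unit_sphere_def elim!: allE eventually_mono)
  then show ?thesis unfolding uniformly_frechet_differentiable_def by blast
qed

lemma uniform_space_image:
  assumes "uniform_space V"
  shows "uniform_space B"
  using assms complex_normed_space_image mcomplete_image uniformly_convex_image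
    uniformly_frechet_differentiable_image
  by (simp add: uniform_space_def banach_space_def)

text \<open>The pulled back semi-inner product of \<open>V\<close> is compatible with \<open>B\<close>, hence the unique one.\<close>

lemma sip_image:
  assumes V: "uniform_space V" and u: "u \<in> points V" and v: "v \<in> points V"
  shows "sip B (J u) (J v) = sip V u v"
proof -
  interpret V: uniform_points V by unfold_locales fact
  interpret B: uniform_points B by unfold_locales (rule uniform_space_image[OF V])
  define I where "I = inv_into (points V) J"
  have I: "I (J f) = f" if "f \<in> points V" for f
    using that J_eq_iff by (auto simp: I_def inj_on_def intro!: inv_into_f_f)
  define S where "S = (\<lambda>f g. sip V (I f) (I g))"
  have S: "S (J f) (J g) = sip V f g" if "f \<in> points V" "g \<in> points V" for f g
    using that I by (simp add: S_def)
  have J0: "J f \<noteq> 0 \<Longrightarrow> f \<noteq> 0" for f using J_zero by auto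
  have "semi_inner_product B S"
    unfolding semi_inner_product_def points_B
    using V.semi_inner_product_sip J0
    by (auto simp: S add_mem scale_mem semi_inner_product_def simp flip: J_add J_scale)
  moreover have "compatible B S"
    using V.compatible_sip by (auto simp: compatible_def points_B S nrm_J)
  ultimately have "S (J u) (J v) = sip B (J u) (J v)"
    using u v by (intro B.compatible_sip_unique) (auto simp: points_B)
  then show ?thesis using S[OF u v] by simp
qed

end

section \<open>The space of feature functions\<close>

lemma continuous_map_ntop:
  assumes V: "complex_normed_space V" and W: "complex_normed_space W"
    and T: "\<And>f. f \<in> points V \<Longrightarrow> T f \<in> points W"
    and diff: "\<And>f g. f \<in> points V \<Longrightarrow> g \<in> points V \<Longrightarrow> nrm W (T f - T g) \<le> \<alpha> * nrm V (f - g)"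
  shows "continuous_map (ntop V) (ntop W) T"
proof -
  interpret V: normed_points V by unfold_locales fact
  interpret Metric_space "points V" "ndist V" by (rule Metric_space_ndist[OF V])
  show ?thesis
    unfolding metric_continuous_map[OF Metric_space_ndist[OF W]]
  proof (intro conjI ballI allI impI)
    show "T ` points V \<subseteq> points W" using T by auto
    fix f and e :: real assume f: "f \<in> points V" and e: "e > 0"
    \<comment> \<open>The constant \<open>\<bar>\<alpha>\<bar> + 1\<close> keeps the radius positive
      when \<alpha> is zero or negative.\<close>
    have "ndist W (T f) (T g) < e" if g: "g \<in> points V" "ndist V f g < e / (\<bar>\<alpha>\<bar> + 1)" for g
    proof -
      have "nrm W (T f - T g) \<le> (\<bar>\<alpha>\<bar> + 1) * nrm V (f - g)"
        using diff[OF f g(1)] V.nrm_nonneg[OF V.diff_mem[OF f g(1)]]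
          mult_right_mono[of \<alpha> "\<bar>\<alpha>\<bar> + 1" "nrm V (f - g)"] by linarith
      also have "\<dots> < e" using g f by (simp add: ndist_def field_simps)
      finally show ?thesis using T f g by (simp add: ndist_def)
    qed
    then show "\<exists>d>0. \<forall>g. g \<in> points V \<and> ndist V f g < d \<longrightarrow> ndist W (T f) (T g) < e"
      using e by (intro exI[of _ "e / (\<bar>\<alpha>\<bar> + 1)"]) auto
  qed
qed

section \<open>The feature space as a reproducing kernel Banach space\<close>

theorem corollary3p2:
  fixes X :: "'x set"
    and L :: "'l::complex_vector space"
    and W :: "'w::complex_vector space"
    and K :: "'x \<Rightarrow> 'x \<Rightarrow> 'l \<Rightarrow> 'l"
    and \<Phi> :: "'x \<Rightarrow> 'w \<Rightarrow> 'l"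
  defines "B \<equiv> feature_space X W \<Phi>"
  assumes "uniform_space L" and "uniform_space W"
    and "\<forall>x\<in>X. \<forall>y\<in>X. K x y \<in> bdd_maps L L"
    and "\<forall>x\<in>X. \<Phi> x \<in> lin_maps W L"
    and "\<forall>x\<in>X. \<forall>y\<in>X. K x y = \<Phi> y \<circ> gadj W L (\<Phi> x)"
    and "ntop (dual W) closure_of
           cspan {duality_map W (gadj W L (\<Phi> x) \<xi>) | x \<xi>. x \<in> X \<and> \<xi> \<in> points L}
         = points (dual W)"
  shows "(\<forall>u\<in>points W. nrm B (feature_fun X \<Phi> u) = nrm W u)
    \<and> semi_inner_product B (sip B) \<and> compatible B (sip B)
    \<and> (\<forall>u\<in>points W. \<forall>v\<in>points W.
          sip B (feature_fun X \<Phi> u) (feature_fun X \<Phi> v) = sip W u v)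
    \<and> rkbs X L B
    \<and> is_reproducing_kernel X L B K"
proof -
  interpret L: uniform_points L by unfold_locales fact
  interpret W: uniform_points W by unfold_locales fact
  define J where "J = feature_fun X \<Phi>"
  have \<Phi>: "\<Phi> x \<in> lin_maps W L" if "x \<in> X" for x using that assms(5) by blast
  have J_apply: "J u x = (if x \<in> X then \<Phi> x u else 0)" for u x
    by (simp add: J_def feature_fun_def extend0_def)
  have add: "J (u + v) = J u + J v" if "u \<in> points W" "v \<in> points W" for u v
    using that lin_mapsD(3)[OF \<Phi>] by (auto simp: fun_eq_iff J_apply)
  have scale: "J (a *\<^sub>C u) = a *\<^sub>C J u" if "u \<in> points W" for a u
    using that lin_mapsD(4)[OF \<Phi>] by (auto simp: fun_eq_iff J_apply scaleC_fun_def)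
  have gadj_mem: "gadj W L (\<Phi> x) \<xi> \<in> points W" if "x \<in> X" "\<xi> \<in> points L" for x \<xi>
    using gadj_bdd_maps[OF assms(3,2) \<Phi>[OF that(1)]] that(2) by (auto simp: bdd_maps_def funs_def)
  have inj: "u = v" if "u \<in> points W" "v \<in> points W" "J u = J v" for u v
  proof -
    have "J (u - v) + J v = J u" using add[OF W.diff_mem[OF that(1,2)] that(2)] by simp
    then have "J (u - v) = 0" using that(3) by simp
    then have zero: "\<Phi> x (u - v) = 0" if "x \<in> X" for x
      using that J_apply[of "u - v" x] by simp
    have uv: "u - v \<in> points W" using W.diff_mem that by blast
    have "u - v = 0"
    proof (rule W.dense_annihilator_eq_0[OF assms(7) uv])
      fix \<phi> assume "\<phi> \<in> {duality_map W (gadj W L (\<Phi> x) \<xi>) | x \<xi>. x \<in> X \<and> \<xi> \<in> points L}"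
      then obtain x \<xi> where x: "x \<in> X" "\<xi> \<in> points L" "\<phi> = duality_map W (gadj W L (\<Phi> x) \<xi>)" by blast
      \<comment> \<open>The adjoint identity moves \<open>\<Phi> x\<close> back onto
        \<open>u - v\<close>, where it vanishes.\<close>
      then have "\<phi> (u - v) = sip L (\<Phi> x (u - v)) \<xi>"
        using sip_gadj[OF assms(3,2) \<Phi> uv] uv by (simp add: duality_map_def extend0_def)
      also have "\<dots> = 0" using zero[OF x(1)] L.sip_scale_left[OF L.zero_mem x(2), of 0] by simp
      finally show "\<phi> (u - v) = 0" .
    qed
    then show ?thesis by simp
  qed
  have points_B: "points B = J ` points W" by (simp add: B_def feature_space_def J_def)
  \<comment> \<open>Injectivity of \<open>J\<close> leaves a single candidate for \<open>THE\<close>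
    in the norm.\<close>
  have nrm_B: "nrm B (J u) = nrm W u" if u: "u \<in> points W" for u
    unfolding B_def feature_space_def space.simps J_def[symmetric]
    using inj u by (intro the_equality) auto
  interpret isometric_image W B J
    by unfold_locales (use points_B nrm_B add scale in auto)
  interpret B: uniform_points B
    by unfold_locales (rule uniform_space_image[OF assms(3)])
  have sip_B: "sip B (J u) (J v) = sip W u v" if "u \<in> points W" "v \<in> points W" for u v
    by (rule sip_image[OF assms(3) that])
  have "continuous_map (ntop B) (ntop L) (\<lambda>f. f x)" if x: "x \<in> X" for x
  proof -
    obtain \<alpha> where \<alpha>: "\<And>u. u \<in> points W \<Longrightarrow> nrm L (\<Phi> x u) \<le> \<alpha> * nrm W u"
      using lin_mapsD(5)[OF \<Phi>[OF x]] by blast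
    have \<alpha>B: "nrm L (f x) \<le> \<alpha> * nrm B f" if "f \<in> points B" for f
      using that \<alpha> x by (auto simp: points_B nrm_B J_apply)
    show ?thesis
    proof (rule continuous_map_ntop[OF image.normed L.normed])
      show "f x \<in> points L" if "f \<in> points B" for f
        using that x lin_mapsD(1)[OF \<Phi>[OF x]] by (auto simp: points_B J_apply)
      show "nrm L (f x - g x) \<le> \<alpha> * nrm B (f - g)" if "f \<in> points B" "g \<in> points B" for f g
        using \<alpha>B[OF image.diff_mem[OF that]] by simp
    qed
  qed
  moreover have "banach_function_space X L B"
    unfolding banach_function_space_def
  proof (intro conjI ballI)
    show "banach_space B" using B.uniform by (simp add: uniform_space_def)
    show sub: "points B \<subseteq> funs X (points L)"
      using lin_mapsD(1)[OF \<Phi>] by (auto simp: points_B funs_def J_apply)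
    \<comment> \<open>Members of \<open>B\<close> vanish off \<open>X\<close>, so vanishing on
      \<open>X\<close> means being the zero function.\<close>
    show "nrm B f = 0 \<longleftrightarrow> (\<forall>x\<in>X. f x = 0)" if "f \<in> points B" for f
      using that sub image.nrm_eq_0[OF that] by (auto simp: funs_def fun_eq_iff)
  qed
  ultimately have rkbs: "rkbs X L B"
    using assms(2) B.uniform by (simp add: rkbs_def)
  \<comment> \<open>The factorization of \<open>K\<close> makes its sections images of adjoint
    vectors. With \<open>sip_B\<close>, the reproducing property becomes the adjoint
    identity.\<close>
  have kernel: "extend0 X (\<lambda>y. K x y \<xi>) = J (gadj W L (\<Phi> x) \<xi>)" if "x \<in> X" for x \<xi>
    using that assms(6) by (auto simp: fun_eq_iff J_apply extend0_def)
  have rep: "reproducing X L B K"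
    unfolding reproducing_def
  proof (intro conjI ballI)
    fix f x \<xi> assume f: "f \<in> points B" and x: "x \<in> X" and \<xi>: "\<xi> \<in> points L"
    obtain u where u: "u \<in> points W" "f = J u" using f by (auto simp: points_B)
    show "sip L (f x) \<xi> = sip B f (extend0 X (\<lambda>y. K x y \<xi>))"
      using sip_gadj[OF assms(3,2) \<Phi>[OF x] u(1) \<xi>] sip_B[OF u(1) gadj_mem[OF x \<xi>]] x
      by (simp add: kernel u(2) J_apply)
  qed (use assms(4) gadj_mem in \<open>auto simp: kernel points_B\<close>)
  \<comment> \<open>Sections of both kernels represent the same functional on \<open>B\<close>, so
    injectivity of the duality mapping identifies them; off the carrier of \<open>L\<close> both
    kernels are zero by \<open>bdd_maps\<close>.\<close>
  have "K' x y = K x y" if K': "reproducing X L B K'" and x: "x \<in> X" and y: "y \<in> X" for K' x y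
  proof
    fix \<xi>
    show "K' x y \<xi> = K x y \<xi>"
    proof (cases "\<xi> \<in> points L")
      case True
      have "extend0 X (\<lambda>y. K' x y \<xi>) = extend0 X (\<lambda>y. K x y \<xi>)"
        using K' rep x True by (intro B.sip_right_cancel) (auto simp: reproducing_def)
      then show ?thesis using y by (metis extend0_def)
    next
      case False
      then show ?thesis using K' rep x y by (auto simp: reproducing_def bdd_maps_def funs_def)
    qed
  qed
  then have rkbs_kernel: "is_reproducing_kernel X L B K"
    unfolding is_reproducing_kernel_def using rep by blast
  show ?thesis
  proof (intro conjI ballI)
    show "nrm B (feature_fun X \<Phi> u) = nrm W u" if "u \<in> points W" for u
      using nrm_B[OF that] by (simp only: J_def)
    show "sip B (feature_fun X \<Phi> u) (feature_fun X \<Phi> v) = sip W u v"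
      if "u \<in> points W" "v \<in> points W" for u v
      using sip_B[OF that] by (simp only: J_def)
  qed (fact B.semi_inner_product_sip B.compatible_sip rkbs rkbs_kernel)+
qed

end
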